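(* Let $\mathbb P$ be a probability measure on $\Omega_+$ under which $(\omega(x))_{x\ge0}$ is i.i.d., such that $\mathbb P$-a.s. $\omega(0,i)=1/2$ for all $i\ge3$, and $\mathbb P[\omega(0,2)=1/2]<1$. Then \[P_0[X_n>0\text{ for all } n>0]=\frac{\mathbb E[\omega(0,1)]\,(\mathbb E[\delta^0]-1)_+}{\mathbb E[(2\omega(0,2)-1)\,\omega(0,1)]}.\]
   Context: Cookie environments: $\Omega_+=([1/2,1]^{\mathbb N})^{\mathbb Z}$, $\omega(x)=(\omega(x,i))_{i\ge1}$. $P_{x,\omega}$ is the law of the nearest-neighbor process $(X_n)_{n\ge0}$ with $X_0=x$ which, on its $i$-th visit to site $z$, jumps to $z+1$ with probability $\omega(z,i)$ and to $z-1$ otherwise. Annealed measure $P_x[\cdot]=\mathbb E[P_{x,\omega}[\cdot]]$. $\delta^0(\omega)=\sum_{i\ge1}(2\omega(0,i)-1)$; $a_+=\max\{a,0\}$. *)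

theory Defs
  imports "HOL-Probability.Probability"
begin

text \<open>Environments: \<open>\<omega> z k\<close> is the cookie strength at site \<open>z\<close> for the
  \<open>(k+1)\<close>-th visit, i.e. \<open>\<omega> z k = \<omega>(z,k+1)\<close> in the paper's 1-based notation.\<close>
type_synonym env = "int \<Rightarrow> nat \<Rightarrow> real"

definition site_space :: "(nat \<Rightarrow> real) measure" where
  "site_space = Pi\<^sub>M UNIV (\<lambda>_. borel)"

definition env_space :: "env measure" where
  "env_space = Pi\<^sub>M UNIV (\<lambda>_. site_space)"

definition unif_seq :: "(nat \<Rightarrow> real) measure" where
  "unif_seq = Pi\<^sub>M UNIV (\<lambda>_. uniform_measure lborel {0..1})"

text \<open>State of the walk after n steps: current position and, for every site,
  the number of previous visits (times m < n with X_m at that site).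
  On its (c y + 1)-th visit to y the walk uses \<open>\<omega> y (c y)\<close>, jumping right
  iff \<open>u n < \<omega> y (c y)\<close>, which has probability \<open>\<omega> y (c y)\<close>.\<close>
primrec walk_state :: "env \<Rightarrow> int \<Rightarrow> (nat \<Rightarrow> real) \<Rightarrow> nat \<Rightarrow> int \<times> (int \<Rightarrow> nat)" where
  "walk_state \<omega> x u 0 = (x, \<lambda>_. 0)"
| "walk_state \<omega> x u (Suc n) =
     (let (y, c) = walk_state \<omega> x u n
      in (if u n < \<omega> y (c y) then y + 1 else y - 1, c(y := c y + 1)))"

definition walk :: "env \<Rightarrow> int \<Rightarrow> (nat \<Rightarrow> real) \<Rightarrow> nat \<Rightarrow> int" where
  "walk \<omega> x u n = fst (walk_state \<omega> x u n)"

definition quenched_prob :: "env \<Rightarrow> int \<Rightarrow> ((nat \<Rightarrow> int) \<Rightarrow> bool) \<Rightarrow> real" where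
  "quenched_prob \<omega> x A = measure unif_seq {u \<in> space unif_seq. A (walk \<omega> x u)}"

definition annealed_prob :: "env measure \<Rightarrow> int \<Rightarrow> ((nat \<Rightarrow> int) \<Rightarrow> bool) \<Rightarrow> real" where
  "annealed_prob M x A = (\<integral>\<omega>. quenched_prob \<omega> x A \<partial>M)"

definition delta0 :: "env \<Rightarrow> real" where
  "delta0 \<omega> = (\<Sum>k. 2 * \<omega> 0 k - 1)"

end

theory Submission
  imports Defs
begin

text \<open>
  Let \<open>p K\<close> be the annealed probability that the walk started at 1 hits \<open>K\<close> before 0, and let
  \<open>d\<close> be the mean total drift of a site and \<open>a = E[(2 \<omega>(0,2) - 1) \<omega>(0,1)]\<close>. Optional stopping of the
  position minus the drift eaten so far shows that \<open>K p K - 1\<close> is the mean drift eaten in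
  \<open>{1..K-1}\<close> before the exit time. The first cookie of a site \<open>x\<close> is eaten with probability \<open>p x\<close>.
  The second one is then missed in two ways: either the walk jumps right and hits \<open>K\<close> before
  returning to \<open>x\<close>, which in the fresh environment to the right has probability \<open>p (K - x)\<close>; or it
  jumps left and hits 0 before \<open>x\<close>, which has probability at most \<open>1/x\<close> as the drift is nonnegative.
  By independence of the sites, \<open>K p K = 1 + (\<Sum>x. p x (d - a p (K - x) - O(1/x)))\<close>; dividing by \<open>K\<close>, the
  limit \<open>l\<close> of \<open>p\<close> solves \<open>l = l (d - a l)\<close>. Since \<open>p\<close> is decreasing with \<open>p K \<ge> 1/K\<close>, the sum
  identity also excludes \<open>l = 0\<close> when \<open>d > 1\<close>.
\<close>

section \<open>Exit means of the quenched walk\<close>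

text \<open>On states (position, visit counts), \<open>stop_op \<omega> D f s\<close> is the quenched mean of \<open>f\<close> after one step,
  the walk being frozen outside \<open>D\<close>; \<open>exit_mean \<omega> D f s\<close> is the mean of \<open>f\<close> at the exit from \<open>D\<close>. As
  a \<open>lim\<close> it is meaningful only when the iterates converge, e.g. for bounded \<open>f\<close> and bounded \<open>D\<close>.\<close>
definition stop_op :: "env \<Rightarrow> int set \<Rightarrow> (int \<times> (int \<Rightarrow> nat) \<Rightarrow> real) \<Rightarrow> int \<times> (int \<Rightarrow> nat) \<Rightarrow> real" where
  "stop_op \<omega> D f = (\<lambda>(y, c). if y \<in> D
     then \<omega> y (c y) * f (y + 1, c(y := c y + 1)) + (1 - \<omega> y (c y)) * f (y - 1, c(y := c y + 1))
     else f (y, c))"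

abbreviation stop_iter where "stop_iter \<omega> D n \<equiv> (stop_op \<omega> D ^^ n)"

definition exit_mean :: "env \<Rightarrow> int set \<Rightarrow> (int \<times> (int \<Rightarrow> nat) \<Rightarrow> real) \<Rightarrow> int \<times> (int \<Rightarrow> nat) \<Rightarrow> real" where
  "exit_mean \<omega> D f s = lim (\<lambda>n. stop_iter \<omega> D n f s)"

definition right_drift :: "env \<Rightarrow> bool" where
  "right_drift \<omega> \<longleftrightarrow> (\<forall>z k. \<omega> z k \<in> {1/2..1})"

text \<open>Invariants of the history, such as "site \<open>x\<close> has not been left yet". They
  make it possible to compare two functions only at those exit states that can occur from the given
  start.\<close>

definition step_closed :: "int set \<Rightarrow> (int \<times> (int \<Rightarrow> nat)) set \<Rightarrow> bool" where
  "step_closed D I \<longleftrightarrow> (\<forall>y c. (y, c) \<in> I \<longrightarrow> y \<in> D \<longrightarrow>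
     (y + 1, c(y := c y + 1)) \<in> I \<and> (y - 1, c(y := c y + 1)) \<in> I)"

lemma right_driftD: "right_drift \<omega> \<Longrightarrow> 1/2 \<le> \<omega> z k" "right_drift \<omega> \<Longrightarrow> \<omega> z k \<le> 1"
  "right_drift \<omega> \<Longrightarrow> 0 \<le> \<omega> z k"
  unfolding right_drift_def by (auto intro: order_trans[of 0 "1/2"])

lemma step_closed_UNIV [simp]: "step_closed D UNIV"
  by (simp add: step_closed_def)

lemma stop_op_outside: "fst s \<notin> D \<Longrightarrow> stop_op \<omega> D f s = f s"
  by (cases s) (simp add: stop_op_def)

section \<open>Algebra and monotonicity of the stopped iterates\<close>

lemma stop_iter_outside: "fst s \<notin> D \<Longrightarrow> stop_iter \<omega> D n f s = f s"
  by (induction n) (auto simp: stop_op_outside)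

lemma stop_iter_inside: "y \<in> D \<Longrightarrow> stop_iter \<omega> D (Suc n) f (y, c) =
    \<omega> y (c y) * stop_iter \<omega> D n f (y + 1, c(y := c y + 1))
    + (1 - \<omega> y (c y)) * stop_iter \<omega> D n f (y - 1, c(y := c y + 1))"
  by (simp add: stop_op_def)

lemma stop_op_mono_on:
  assumes "right_drift \<omega>" "step_closed D I" "\<And>s. s \<in> I \<Longrightarrow> f s \<le> g s" "s \<in> I"
  shows "stop_op \<omega> D f s \<le> stop_op \<omega> D g s"
proof (cases s)
  case (Pair y c)
  then show ?thesis
    using assms right_driftD[OF assms(1), of y "c y"]
    by (auto simp: stop_op_def step_closed_def intro!: add_mono mult_left_mono)
qed

lemma stop_iter_mono_on:
  assumes "right_drift \<omega>" "step_closed D I" "\<And>s. s \<in> I \<Longrightarrow> f s \<le> g s" "s \<in> I"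
  shows "stop_iter \<omega> D n f s \<le> stop_iter \<omega> D n g s"
  using assms(4)
proof (induction n arbitrary: s)
  case (Suc n)
  then show ?case
    using stop_op_mono_on[OF assms(1,2), of "stop_iter \<omega> D n f" "stop_iter \<omega> D n g"] by simp
qed (use assms in auto)

lemma stop_op_const: "stop_op \<omega> D (\<lambda>_. k) = (\<lambda>_. k)"
  by (auto simp: stop_op_def fun_eq_iff algebra_simps)

lemma stop_iter_harmonic: "stop_op \<omega> D f = f \<Longrightarrow> stop_iter \<omega> D n f = f"
  by (induction n) auto

lemma stop_op_add: "stop_op \<omega> D (\<lambda>s. f s + g s) = (\<lambda>s. stop_op \<omega> D f s + stop_op \<omega> D g s)"
  by (auto simp: stop_op_def fun_eq_iff algebra_simps)

lemma stop_op_cmult: "stop_op \<omega> D (\<lambda>s. k * f s) = (\<lambda>s. k * stop_op \<omega> D f s)"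
  by (auto simp: stop_op_def fun_eq_iff algebra_simps)

lemma stop_iter_add: "stop_iter \<omega> D n (\<lambda>s. f s + g s) = (\<lambda>s. stop_iter \<omega> D n f s + stop_iter \<omega> D n g s)"
  by (induction n) (auto simp: stop_op_add)

lemma stop_iter_cmult: "stop_iter \<omega> D n (\<lambda>s. k * f s) = (\<lambda>s. k * stop_iter \<omega> D n f s)"
  by (induction n) (auto simp: stop_op_cmult)

lemma stop_iter_abs_le:
  assumes "right_drift \<omega>" "\<And>s. \<bar>f s\<bar> \<le> B"
  shows "\<bar>stop_iter \<omega> D n f s\<bar> \<le> B"
proof -
  have "stop_iter \<omega> D n f s \<le> stop_iter \<omega> D n (\<lambda>_. B) s"
    by (rule stop_iter_mono_on[OF assms(1) step_closed_UNIV]) (use assms(2) in \<open>auto simp: abs_le_iff\<close>)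
  moreover have "stop_iter \<omega> D n (\<lambda>_. - B) s \<le> stop_iter \<omega> D n f s"
    by (rule stop_iter_mono_on[OF assms(1) step_closed_UNIV]) (use assms(2) in \<open>auto simp: abs_le_iff minus_le_iff\<close>)
  ultimately show ?thesis
    by (simp add: stop_iter_harmonic[OF stop_op_const] abs_le_iff)
qed

text \<open>The concave function \<open>(b - a)\<^sup>2 - (y - a)\<^sup>2\<close> loses at least 1 on average in each step,
  so it dominates the expected exit time.\<close>
lemma survival_bound:
  assumes "right_drift \<omega>" "a \<le> y" "y \<le> b"
  shows "real n * stop_iter \<omega> {a<..<b} n (\<lambda>s. of_bool (fst s \<in> {a<..<b})) (y, c)
     \<le> (of_int b - of_int a)\<^sup>2 - (of_int y - of_int a)\<^sup>2"
  using assms(2,3)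
proof (induction n arbitrary: y c)
  case 0
  then show ?case by (auto intro!: power_mono)
next
  case (Suc n)
  let ?I = "\<lambda>n. stop_iter \<omega> {a<..<b} n (\<lambda>s. of_bool (fst s \<in> {a<..<b}) :: real)"
  show ?case
  proof (cases "y \<in> {a<..<b}")
    case False
    then show ?thesis using Suc.prems
      by (subst stop_iter_outside) (auto intro!: power_mono)
  next
    case True
    define w where "w = \<omega> y (c y)"
    define d :: real where "d = of_int y - of_int a"
    have w: "1/2 \<le> w" "w \<le> 1" using right_driftD[OF assms(1)] by (auto simp: w_def)
    have d: "d > 0" using True by (simp add: d_def)
    let ?R = "?I n (y + 1, c(y := c y + 1))" and ?L = "?I n (y - 1, c(y := c y + 1))"
    let ?C = "(of_int b - of_int a)\<^sup>2 :: real"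
    have R: "real n * ?R \<le> ?C - (d + 1)\<^sup>2"
      using Suc.IH[of "y + 1" "c(y := c y + 1)"] True unfolding d_def by (simp add: add_diff_eq diff_add_eq fun_upd_def)
    have L: "real n * ?L \<le> ?C - (d - 1)\<^sup>2"
      using Suc.IH[of "y - 1" "c(y := c y + 1)"] True unfolding d_def by (simp add: diff_diff_eq add.commute fun_upd_def)
    have RL: "?R \<le> 1" "?L \<le> 1"
      using stop_iter_abs_le[OF assms(1), of "\<lambda>s. of_bool (fst s \<in> {a<..<b})" 1] by (auto simp: abs_le_iff)
    have "real (Suc n) * ?I (Suc n) (y, c) = w * (real n * ?R) + (1 - w) * (real n * ?L) + (w * ?R + (1 - w) * ?L)"
      unfolding stop_iter_inside[OF True] w_def by (simp add: algebra_simps)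
    also have "\<dots> \<le> w * (?C - (d + 1)\<^sup>2) + (1 - w) * (?C - (d - 1)\<^sup>2) + (w * 1 + (1 - w) * 1)"
      using w R L RL by (intro add_mono mult_left_mono) auto
    \<comment> \<open>The variance of a fair step lowers the concave bound by exactly 1, which pays
      for the extra unit of time; the drift term only helps, since \<open>d > 0\<close>.\<close>
    also have "\<dots> = ?C - d\<^sup>2 - 2 * d * (2 * w - 1)"
      by (simp add: power2_eq_square algebra_simps)
    also have "\<dots> \<le> ?C - d\<^sup>2" using w d by simp
    finally show ?thesis by (simp add: d_def)
  qed
qed

lemma survival_tendsto_0:
  assumes "right_drift \<omega>"
  shows "(\<lambda>n. stop_iter \<omega> {a<..<b} n (\<lambda>s. of_bool (fst s \<in> {a<..<b})) s) \<longlonglongrightarrow> 0"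
proof (cases "fst s \<in> {a<..<b}")
  case False
  then show ?thesis by (subst stop_iter_outside) auto
next
  case True
  obtain y c where s: "s = (y, c)" by (cases s)
  let ?I = "\<lambda>n. stop_iter \<omega> {a<..<b} n (\<lambda>s. of_bool (fst s \<in> {a<..<b}) :: real) s"
  let ?C = "(of_int b - of_int a)\<^sup>2 - (of_int y - of_int a)\<^sup>2 :: real"
  have up: "?I n \<le> ?C / real n" if "n > 0" for n
    using survival_bound[OF assms, of a y b n c] True that s by (simp add: field_simps)
  have lo: "0 \<le> ?I n" for n
    using stop_iter_mono_on[OF assms step_closed_UNIV, where f = "\<lambda>_. 0" and g = "\<lambda>s. of_bool (fst s \<in> {a<..<b})" and s = s and D = "{a<..<b}" and n = n]
    by (simp add: stop_iter_harmonic[OF stop_op_const])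
  show ?thesis
  proof (rule tendsto_sandwich[of "\<lambda>_. 0" _ _ "\<lambda>n. ?C / real n"])
    show "eventually (\<lambda>n. ?I n \<le> ?C / real n) sequentially"
      using eventually_gt_at_top[of "0::nat"] by (rule eventually_mono) (rule up)
  qed (use lo lim_const_over_n in auto)
qed

text \<open>After \<open>n\<close> steps the walk has either left \<open>D\<close>, where
  \<open>f\<close> is at most \<open>g\<close>, or is still inside, where the two differ by at most
  \<open>2 * B\<close>. The latter event is charged to the survival probability.\<close>

lemma stop_iter_diff_bound:
  assumes "right_drift \<omega>" "step_closed D I" "s \<in> I"
    and "\<And>s. s \<in> I \<Longrightarrow> fst s \<notin> D \<Longrightarrow> f s \<le> g s"
    and "\<And>s. \<bar>f s\<bar> \<le> B" "\<And>s. \<bar>g s\<bar> \<le> B"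
  shows "stop_iter \<omega> D n f s \<le> stop_iter \<omega> D n g s + 2 * B * stop_iter \<omega> D n (\<lambda>s. of_bool (fst s \<in> D)) s"
proof -
  have "stop_iter \<omega> D n f s \<le> stop_iter \<omega> D n (\<lambda>s. g s + 2 * B * of_bool (fst s \<in> D)) s"
  proof (rule stop_iter_mono_on[OF assms(1,2) _ assms(3)])
    fix s assume "s \<in> I"
    then show "f s \<le> g s + 2 * B * of_bool (fst s \<in> D)"
      using assms(4)[of s] assms(5)[of s] assms(6)[of s] by (cases "fst s \<in> D") auto
  qed
  then show ?thesis by (simp add: stop_iter_add stop_iter_cmult)
qed

text \<open>The iterates are Cauchy: \<open>m\<close> further steps change nothing once the walk is
  frozen, so iterates \<open>n\<close> and \<open>n + m\<close> differ by at most
  \<open>2 * B\<close> times the probability of still being inside after \<open>n\<close> steps, and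
  this tends to 0.\<close>

lemma exit_mean_tendsto:
  assumes "right_drift \<omega>" "\<And>s. \<bar>f s\<bar> \<le> B"
  shows "(\<lambda>n. stop_iter \<omega> {a<..<b} n f s) \<longlonglongrightarrow> exit_mean \<omega> {a<..<b} f s"
proof -
  let ?D = "{a<..<b}"
  let ?I = "\<lambda>n. stop_iter \<omega> ?D n (\<lambda>s. of_bool (fst s \<in> ?D) :: real) s"
  have cmp: "\<bar>stop_iter \<omega> ?D (n + m) f s - stop_iter \<omega> ?D n f s\<bar> \<le> 2 * B * ?I n" for n m
  proof -
    have B: "\<bar>stop_iter \<omega> ?D m f s\<bar> \<le> B" for s by (rule stop_iter_abs_le[OF assms])
    have e: "stop_iter \<omega> ?D (n + m) f = stop_iter \<omega> ?D n (stop_iter \<omega> ?D m f)"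
      by (simp add: funpow_add)
    have "stop_iter \<omega> ?D n (stop_iter \<omega> ?D m f) s \<le> stop_iter \<omega> ?D n f s + 2 * B * ?I n"
      by (rule stop_iter_diff_bound[OF assms(1) step_closed_UNIV]) (auto simp: stop_iter_outside B assms(2))
    moreover have "stop_iter \<omega> ?D n f s \<le> stop_iter \<omega> ?D n (stop_iter \<omega> ?D m f) s + 2 * B * ?I n"
      by (rule stop_iter_diff_bound[OF assms(1) step_closed_UNIV]) (auto simp: stop_iter_outside B assms(2))
    ultimately show ?thesis unfolding e by (simp add: abs_le_iff)
  qed
  have "(\<lambda>n. 2 * B * ?I n) \<longlonglongrightarrow> 0"
    using tendsto_mult_left[OF survival_tendsto_0[OF assms(1)], of "2 * B"] by simp
  then have "Cauchy (\<lambda>n. stop_iter \<omega> ?D n f s)"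
  proof (intro metric_CauchyI)
    fix e :: real assume "e > 0"
    assume "(\<lambda>n. 2 * B * ?I n) \<longlonglongrightarrow> 0"
    then obtain N where N: "2 * B * ?I N < e / 2"
      using order_tendstoD(2)[of _ 0 sequentially "e / 2"] \<open>e > 0\<close>
      by (metis (no_types, lifting) eventually_sequentially half_gt_zero order_refl)
    have "dist (stop_iter \<omega> ?D m f s) (stop_iter \<omega> ?D n f s) < e" if "m \<ge> N" "n \<ge> N" for m n
      using cmp[of N "m - N"] cmp[of N "n - N"] that N by (simp add: dist_real_def)
    then show "\<exists>N. \<forall>m\<ge>N. \<forall>n\<ge>N. dist (stop_iter \<omega> ?D m f s) (stop_iter \<omega> ?D n f s) < e" by blast
  qed
  then show ?thesis
    unfolding exit_mean_def by (simp add: Cauchy_convergent_iff convergent_LIMSEQ_iff)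
qed

section \<open>Calculus of exit means: comparison, tower property, linearity\<close>

lemma exit_mean_outside: "fst s \<notin> D \<Longrightarrow> exit_mean \<omega> D f s = f s"
  by (simp add: exit_mean_def stop_iter_outside)

lemma exit_mean_harmonic: "stop_op \<omega> D f = f \<Longrightarrow> exit_mean \<omega> D f = f"
  by (rule ext) (simp add: exit_mean_def stop_iter_harmonic)

lemma exit_mean_abs_le:
  assumes "right_drift \<omega>" "\<And>s. \<bar>f s\<bar> \<le> B"
  shows "\<bar>exit_mean \<omega> {a<..<b} f s\<bar> \<le> B"
  by (rule LIMSEQ_le_const2[OF tendsto_rabs[OF exit_mean_tendsto[OF assms]]])
     (use stop_iter_abs_le[OF assms] in auto)

text \<open>The walk leaves a bounded interval almost surely, so the values of \<open>f\<close> and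
  \<open>g\<close> inside are irrelevant in the limit. Hence comparing them at the exit states in
  the invariant set suffices.\<close>

lemma exit_mean_mono_on:
  assumes "right_drift \<omega>" "step_closed {a<..<b} I" "s \<in> I"
    and "\<And>s. s \<in> I \<Longrightarrow> fst s \<notin> {a<..<b} \<Longrightarrow> f s \<le> g s"
    and "\<And>s. \<bar>f s\<bar> \<le> B" "\<And>s. \<bar>g s\<bar> \<le> B'"
  shows "exit_mean \<omega> {a<..<b} f s \<le> exit_mean \<omega> {a<..<b} g s"
proof -
  let ?D = "{a<..<b}"
  have f: "\<bar>f s\<bar> \<le> max B B'" and g: "\<bar>g s\<bar> \<le> max B B'" for s using assms(5,6)[of s] by auto
  have "(\<lambda>n. stop_iter \<omega> ?D n g s + 2 * max B B' * stop_iter \<omega> ?D n (\<lambda>s. of_bool (fst s \<in> ?D)) s)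
      \<longlonglongrightarrow> exit_mean \<omega> ?D g s + 2 * max B B' * 0"
    by (intro tendsto_add tendsto_mult_left survival_tendsto_0 exit_mean_tendsto[OF assms(1) g] assms(1))
  from LIMSEQ_le[OF exit_mean_tendsto[OF assms(1) f] this]
  show ?thesis
    using stop_iter_diff_bound[OF assms(1-4) f g] by auto
qed

lemma exit_mean_cong_on:
  assumes "right_drift \<omega>" "step_closed {a<..<b} I" "s \<in> I"
    and "\<And>s. s \<in> I \<Longrightarrow> fst s \<notin> {a<..<b} \<Longrightarrow> f s = g s"
    and "\<And>s. \<bar>f s\<bar> \<le> B" "\<And>s. \<bar>g s\<bar> \<le> B'"
  shows "exit_mean \<omega> {a<..<b} f s = exit_mean \<omega> {a<..<b} g s"
  by (rule antisym; rule exit_mean_mono_on[OF assms(1-3)]; (rule assms(5,6))?) (simp_all add: assms(4))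

text \<open>One application of the step operator shifts the iteration index by one and leaves the
  limit unchanged. Allowing a smaller \<open>D\<close> prepares for stopping the walk early.\<close>

lemma exit_mean_is_harmonic:
  assumes "right_drift \<omega>" "\<And>s. \<bar>f s\<bar> \<le> B" "D \<subseteq> {a<..<b}"
  shows "stop_op \<omega> D (exit_mean \<omega> {a<..<b} f) = exit_mean \<omega> {a<..<b} f"
proof
  fix s :: "int \<times> (int \<Rightarrow> nat)"
  obtain y c where s: "s = (y, c)" by (cases s)
  show "stop_op \<omega> D (exit_mean \<omega> {a<..<b} f) s = exit_mean \<omega> {a<..<b} f s"
  proof (cases "y \<in> D")
    case True
    have "(\<lambda>n. stop_iter \<omega> {a<..<b} (Suc n) f (y, c)) \<longlonglongrightarrow> stop_op \<omega> D (exit_mean \<omega> {a<..<b} f) (y, c)"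
      using True assms(3) 
      by (subst stop_iter_inside) (auto simp: stop_op_def intro!: tendsto_add tendsto_mult_left exit_mean_tendsto[OF assms(1,2)])
    from LIMSEQ_unique[OF this LIMSEQ_Suc[OF exit_mean_tendsto[OF assms(1,2)]]]
    show ?thesis by (simp add: s)
  qed (simp add: stop_op_outside s)
qed

text \<open>The strong Markov property at the exit from the smaller set \<open>D\<close>, in the
  form in which the arguments below use it.\<close>

lemma exit_mean_tower:
  assumes "right_drift \<omega>" "\<And>s. \<bar>f s\<bar> \<le> B" "D \<subseteq> {a<..<b}"
  shows "exit_mean \<omega> D (exit_mean \<omega> {a<..<b} f) = exit_mean \<omega> {a<..<b} f"
  by (rule exit_mean_harmonic[OF exit_mean_is_harmonic[OF assms]])

lemma exit_mean_step:
  assumes "right_drift \<omega>" "\<And>s. \<bar>f s\<bar> \<le> B" "y \<in> {a<..<b}"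
  shows "exit_mean \<omega> {a<..<b} f (y, c) =
    \<omega> y (c y) * exit_mean \<omega> {a<..<b} f (y + 1, c(y := c y + 1))
    + (1 - \<omega> y (c y)) * exit_mean \<omega> {a<..<b} f (y - 1, c(y := c y + 1))"
  using fun_cong[where x = "(y, c)", OF exit_mean_is_harmonic[where D = "{a<..<b}" and a = a and b = b, OF assms(1,2) order_refl]] assms(3)
  by (simp add: stop_op_def)

lemma exit_mean_add:
  assumes "right_drift \<omega>" "\<And>s. \<bar>f s\<bar> \<le> B" "\<And>s. \<bar>g s\<bar> \<le> B'"
  shows "exit_mean \<omega> {a<..<b} (\<lambda>s. f s + g s) s = exit_mean \<omega> {a<..<b} f s + exit_mean \<omega> {a<..<b} g s"
proof -
  have "\<bar>f s + g s\<bar> \<le> B + B'" for s using assms(2,3)[of s] by linarith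
  from exit_mean_tendsto[OF assms(1) this]
  have "(\<lambda>n. stop_iter \<omega> {a<..<b} n f s + stop_iter \<omega> {a<..<b} n g s)
      \<longlonglongrightarrow> exit_mean \<omega> {a<..<b} (\<lambda>s. f s + g s) s"
    by (simp add: stop_iter_add)
  then show ?thesis
    by (rule LIMSEQ_unique)
       (rule tendsto_add[OF exit_mean_tendsto[OF assms(1,2)] exit_mean_tendsto[OF assms(1,3)]])
qed

lemma exit_mean_cmult:
  assumes "right_drift \<omega>" "\<And>s. \<bar>f s\<bar> \<le> B"
  shows "exit_mean \<omega> {a<..<b} (\<lambda>s. k * f s) s = k * exit_mean \<omega> {a<..<b} f s"
proof -
  have "(\<lambda>n. stop_iter \<omega> {a<..<b} n (\<lambda>s. k * f s) s) \<longlonglongrightarrow> k * exit_mean \<omega> {a<..<b} f s"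
    by (simp add: stop_iter_cmult tendsto_mult_left exit_mean_tendsto[OF assms])
  then show ?thesis unfolding exit_mean_def[of \<omega> _ "\<lambda>s. k * f s"] by (rule limI)
qed

lemma exit_mean_const: "exit_mean \<omega> D (\<lambda>_. k) s = k"
  by (simp add: exit_mean_harmonic stop_op_const)

lemma exit_mean_sum:
  assumes "right_drift \<omega>" "finite X" "\<And>x s. \<bar>f x s\<bar> \<le> B"
  shows "exit_mean \<omega> {a<..<b} (\<lambda>s. \<Sum>x\<in>X. f x s) s = (\<Sum>x\<in>X. exit_mean \<omega> {a<..<b} (f x) s)"
  using assms(2)
proof (induction X)
  case (insert x X)
  have "\<bar>\<Sum>x\<in>X. f x s\<bar> \<le> (\<Sum>x\<in>X. B)" for s
    by (rule order_trans[OF sum_abs sum_mono]) (rule assms(3))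
  from exit_mean_add[where a = a and b = b and s = s, OF assms(1) assms(3)[of x] this] insert
  show ?case by simp
qed (simp add: exit_mean_const)

section \<open>Hitting probabilities and consumed drift\<close>

abbreviation reach :: "int \<Rightarrow> int \<times> (int \<Rightarrow> nat) \<Rightarrow> real" where
  "reach b s \<equiv> of_bool (b \<le> fst s)"

text \<open>The walk starts next to \<open>a\<close> with all sites fresh, and \<open>a\<close>
  plays the role of 0. The mean of \<open>hit \<omega> 0 K\<close> over the environment is the
  \<open>p K\<close> of the proof idea.\<close>

definition hit :: "env \<Rightarrow> int \<Rightarrow> int \<Rightarrow> real" where
  "hit \<omega> a b = exit_mean \<omega> {a<..<b} (reach b) (a + 1, \<lambda>_. 0)"

lemma stop_iter_shift:
  assumes "\<And>z. z + x \<in> D' \<longleftrightarrow> z \<in> D" "\<And>z. z \<in> D \<Longrightarrow> \<omega> z = \<omega>' (z + x)" "\<And>z. F z = F' (z + x)"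
    and "\<And>z. z \<in> D \<Longrightarrow> c z = c' (z + x)"
  shows "stop_iter \<omega> D n (\<lambda>s. F (fst s)) (y, c) = stop_iter \<omega>' D' n (\<lambda>s. F' (fst s)) (y + x, c')"
  using assms(4)
proof (induction n arbitrary: y c c')
  case 0
  then show ?case using assms(3) by simp
next
  case (Suc n)
  show ?case
  proof (cases "y \<in> D")
    case True
    have D': "y + x \<in> D'" using True assms(1) by simp
    have "stop_iter \<omega> D n (\<lambda>s. F (fst s)) (y + 1, c(y := c y + 1))
        = stop_iter \<omega>' D' n (\<lambda>s. F' (fst s)) (y + 1 + x, c'(y + x := c' (y + x) + 1))"
      by (rule Suc.IH) (use Suc.prems True in auto)
    moreover have "stop_iter \<omega> D n (\<lambda>s. F (fst s)) (y - 1, c(y := c y + 1))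
        = stop_iter \<omega>' D' n (\<lambda>s. F' (fst s)) (y - 1 + x, c'(y + x := c' (y + x) + 1))"
      by (rule Suc.IH) (use Suc.prems True in auto)
    ultimately show ?thesis
      unfolding stop_iter_inside[OF True] stop_iter_inside[OF D']
      using assms(2)[OF True] Suc.prems[OF True] by (simp add: algebra_simps)
  next
    case False
    then have D': "y + x \<notin> D'" using assms(1) by simp
    show ?thesis
      using False D' by (simp del: funpow.simps add: stop_iter_outside assms(3))
  qed
qed

lemma exit_mean_reach_shift:
  assumes "\<And>z. a < z \<Longrightarrow> z < b \<Longrightarrow> \<omega> z = \<omega>' (z + x) \<and> c z = c' (z + x)"
  shows "exit_mean \<omega> {a<..<b} (reach b) (y, c) = exit_mean \<omega>' {a+x<..<b+x} (reach (b+x)) (y + x, c')"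
  unfolding exit_mean_def
  by (subst stop_iter_shift[where F = "\<lambda>z. of_bool (b \<le> z)" and F' = "\<lambda>z. of_bool (b + x \<le> z)"
        and D' = "{a+x<..<b+x}" and x = x and \<omega>' = \<omega>' and c' = c']) (use assms in auto)

lemma hit_shift:
  assumes "\<And>z. a < z \<Longrightarrow> z < b \<Longrightarrow> \<omega> z = \<omega>' (z + x)"
  shows "hit \<omega> a b = hit \<omega>' (a + x) (b + x)"
  unfolding hit_def
  by (subst exit_mean_reach_shift[where x = x and \<omega>' = \<omega>' and c' = "\<lambda>_. 0"]) (use assms in \<open>auto simp: algebra_simps\<close>)

lemma exit_mean_reach_bounds:
  assumes "right_drift \<omega>"
  shows "0 \<le> exit_mean \<omega> {a<..<b} (reach b') s" "exit_mean \<omega> {a<..<b} (reach b') s \<le> 1"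
  using exit_mean_mono_on[OF assms step_closed_UNIV UNIV_I, where f = "\<lambda>_. 0" and g = "reach b'" and a = a and b = b and s = s and B = 1 and B' = 1]
    exit_mean_mono_on[OF assms step_closed_UNIV UNIV_I, where f = "reach b'" and g = "\<lambda>_. 1" and a = a and b = b and s = s and B = 1 and B' = 1]
  by (auto simp: exit_mean_const)

lemma hit_bounds: "right_drift \<omega> \<Longrightarrow> 0 \<le> hit \<omega> a b" "right_drift \<omega> \<Longrightarrow> hit \<omega> a b \<le> 1"
  by (simp_all add: hit_def exit_mean_reach_bounds)

text \<open>Clamping turns the position into a bounded function without changing it on the closed
  interval. Outside the open interval it only takes the values 0 and \<open>b\<close>.\<close>

lemma exit_mean_clamp:
  assumes "right_drift \<omega>" "0 \<le> b"
  shows "exit_mean \<omega> {0<..<b} (\<lambda>s. of_int (max 0 (min b (fst s)))) s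
       = of_int b * exit_mean \<omega> {0<..<b} (reach b) s"
proof -
  have "exit_mean \<omega> {0<..<b} (\<lambda>s. of_int (max 0 (min b (fst s)))) s = exit_mean \<omega> {0<..<b} (\<lambda>s. of_int b * reach b s) s"
    by (rule exit_mean_cong_on[OF assms(1) step_closed_UNIV UNIV_I, where B = "of_int b" and B' = "of_int b"])
       (use assms(2) in auto)
  also have "\<dots> = of_int b * exit_mean \<omega> {0<..<b} (reach b) s"
    by (rule exit_mean_cmult[where B = 1]) (use assms in auto)
  finally show ?thesis .
qed

text \<open>As all drifts are nonnegative, the clamped position is a submartingale, whatever the
  visit counts are. The bound is the value for the simple symmetric walk.\<close>

lemma reach_prob_ge:
  assumes "right_drift \<omega>" "0 \<le> y" "y \<le> b" "0 < b"
  shows "of_int y / of_int b \<le> exit_mean \<omega> {0<..<b} (reach b) (y, c)"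
proof -
  let ?q = "\<lambda>s :: int \<times> (int \<Rightarrow> nat). of_int (max 0 (min b (fst s))) :: real"
  have sub: "?q s \<le> stop_op \<omega> {0<..<b} ?q s" for s
  proof (cases s)
    case (Pair z c)
    show ?thesis
    proof (cases "z \<in> {0<..<b}")
      case True
      then have "stop_op \<omega> {0<..<b} ?q s = of_int z + (2 * \<omega> z (c z) - 1)"
        using Pair by (simp add: stop_op_def algebra_simps)
      then show ?thesis using True Pair right_driftD(1)[OF assms(1), of z "c z"] by auto
    qed (simp add: stop_op_outside Pair)
  qed
  have iter: "?q s \<le> stop_iter \<omega> {0<..<b} n ?q s" for n s
  proof (induction n arbitrary: s)
    case (Suc n)
    have "?q s \<le> stop_op \<omega> {0<..<b} ?q s" by (rule sub)
    also have "\<dots> \<le> stop_op \<omega> {0<..<b} (stop_iter \<omega> {0<..<b} n ?q) s"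
      by (rule stop_op_mono_on[OF assms(1) step_closed_UNIV Suc.IH UNIV_I])
    finally show ?case by simp
  qed simp
  have "?q (y, c) \<le> exit_mean \<omega> {0<..<b} ?q (y, c)"
    by (rule LIMSEQ_le_const[OF exit_mean_tendsto[where B = "of_int b"]])
       (use assms iter[of "(y, c)"] in \<open>simp_all del: of_int_max of_int_min\<close>)
  then show ?thesis
    using assms by (simp add: exit_mean_clamp field_simps)
qed

lemma hit_ge: "right_drift \<omega> \<Longrightarrow> 0 < b \<Longrightarrow> 1 / of_int b \<le> hit \<omega> 0 b"
  using reach_prob_ge[of \<omega> 1 b "\<lambda>_. 0"] by (simp add: hit_def)

text \<open>Counts increase when the walk leaves a site. For \<open>x\<close> inside the interval,
  at the exit time this therefore says that at least \<open>k\<close> cookies of \<open>x\<close>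
  have been eaten.\<close>

abbreviation visited :: "nat \<Rightarrow> int \<Rightarrow> int \<times> (int \<Rightarrow> nat) \<Rightarrow> real" where
  "visited k x s \<equiv> of_bool (k \<le> snd s x)"

text \<open>Optional stopping for the position minus the drift consumed so far.\<close>
lemma hit_drift_identity:
  assumes "right_drift \<omega>" "0 < K" "\<And>x k. 0 < x \<Longrightarrow> x < K \<Longrightarrow> 2 \<le> k \<Longrightarrow> \<omega> x k = 1/2"
  shows "of_int K * hit \<omega> 0 K = 1 + (\<Sum>x\<in>{0<..<K}.
      (2 * \<omega> x 0 - 1) * exit_mean \<omega> {0<..<K} (visited (Suc 0) x) (1, \<lambda>_. 0)
    + (2 * \<omega> x (Suc 0) - 1) * exit_mean \<omega> {0<..<K} (visited 2 x) (1, \<lambda>_. 0))"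
proof -
  let ?D = "{0<..<K}" and ?s = "(1, \<lambda>_. 0) :: int \<times> (int \<Rightarrow> nat)"
  let ?q = "\<lambda>s :: int \<times> (int \<Rightarrow> nat). of_int (max 0 (min K (fst s))) :: real"
  define f where "f x s = (2 * \<omega> x 0 - 1) * visited (Suc 0) x s + (2 * \<omega> x (Suc 0) - 1) * visited 2 x s" for x s
  \<comment> \<open>The martingale: clamped position minus the drift eaten so far. The factor
    \<open>- 1\<close> fits the scaling rule for exit means.\<close>
  define \<Phi> where "\<Phi> s = ?q s + - 1 * (\<Sum>x\<in>?D. f x s)" for s
  have f_abs: "\<bar>f x s\<bar> \<le> 2" for x s
    using right_driftD[OF assms(1), of x 0] right_driftD[OF assms(1), of x 1] by (auto simp: f_def)
  have fsum_abs: "\<bar>\<Sum>x\<in>?D. f x s\<bar> \<le> of_nat (card ?D) * 2" for s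
    using order_trans[OF sum_abs[of "\<lambda>x. f x s" ?D] sum_mono[of ?D "\<lambda>x. \<bar>f x s\<bar>" "\<lambda>_. 2"]] f_abs by simp
  have fsum: "exit_mean \<omega> ?D (\<lambda>s. - 1 * (\<Sum>x\<in>?D. f x s)) ?s = - 1 * (\<Sum>x\<in>?D. exit_mean \<omega> ?D (f x) ?s)"
    by (subst exit_mean_cmult[OF assms(1) fsum_abs]) (simp add: exit_mean_sum[OF assms(1) _ f_abs])
  \<comment> \<open>Leaving \<open>y\<close> eats exactly the cookie with index \<open>c y\<close>.
    From the third visit on this cookie is fair, in agreement with \<open>f\<close> recording two
    visits only.\<close>
  have upd: "(\<Sum>x\<in>?D. f x (y', c(y := c y + 1))) = (\<Sum>x\<in>?D. f x (y, c)) + (2 * \<omega> y (c y) - 1)"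
    if "y \<in> ?D" for y y' c
  proof -
    consider "c y = 0" | "c y = Suc 0" | "2 \<le> c y" by linarith
    then have "f y (y', c(y := c y + 1)) = f y (y, c) + (2 * \<omega> y (c y) - 1)"
      using assms(3)[of y "c y"] that by cases (auto simp: f_def)
    moreover have "(\<Sum>x\<in>?D - {y}. f x (y', c(y := c y + 1))) = (\<Sum>x\<in>?D - {y}. f x (y, c))"
      by (rule sum.cong) (auto simp: f_def)
    ultimately show ?thesis using that by (simp add: sum.remove[of ?D y])
  qed
  have "stop_op \<omega> ?D \<Phi> = \<Phi>"
  proof
    fix s :: "int \<times> (int \<Rightarrow> nat)"
    obtain y c where s: "s = (y, c)" by (cases s)
    show "stop_op \<omega> ?D \<Phi> s = \<Phi> s"
    proof (cases "y \<in> ?D")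
      case True
      have "?q (y + 1, c) = of_int y + 1" "?q (y - 1, c) = of_int y - 1" "?q (y, c) = of_int y"
        using True by auto
      then show ?thesis
        using True unfolding s stop_op_def \<Phi>_def by (simp add: upd[OF True, simplified] algebra_simps)
    qed (simp add: stop_op_outside s)
  qed
  then have "exit_mean \<omega> ?D \<Phi> ?s = \<Phi> ?s" by (simp add: exit_mean_harmonic)
  also have "\<dots> = 1" using assms(2) by (simp add: \<Phi>_def f_def)
  finally have "1 = exit_mean \<omega> ?D ?q ?s + exit_mean \<omega> ?D (\<lambda>s. - 1 * (\<Sum>x\<in>?D. f x s)) ?s"
    unfolding \<Phi>_def
    by (subst (asm) exit_mean_add[OF assms(1), where B = "of_int K" and B' = "of_nat (card ?D) * 2"])
       (use assms(2) fsum_abs in auto)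
  also have "exit_mean \<omega> ?D ?q ?s = of_int K * hit \<omega> 0 K"
    using assms by (simp add: exit_mean_clamp hit_def)
  finally have eq: "of_int K * hit \<omega> 0 K = 1 + (\<Sum>x\<in>?D. exit_mean \<omega> ?D (f x) ?s)" by (simp only: fsum)
  have "exit_mean \<omega> ?D (f x) ?s = (2 * \<omega> x 0 - 1) * exit_mean \<omega> ?D (visited (Suc 0) x) ?s
      + (2 * \<omega> x (Suc 0) - 1) * exit_mean \<omega> ?D (visited 2 x) ?s" for x
    unfolding f_def
    by (subst exit_mean_add[OF assms(1), where B = "\<bar>2 * \<omega> x 0 - 1\<bar>" and B' = "\<bar>2 * \<omega> x (Suc 0) - 1\<bar>"])
       (auto simp: exit_mean_cmult[OF assms(1), where B = 1])
  then show ?thesis by (simp only: eq)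
qed

section \<open>Probabilities of eating the first and the second cookie of a site\<close>

lemma exit_mean_visited_eq_1:
  assumes "right_drift \<omega>" "k \<le> c x"
  shows "exit_mean \<omega> {a<..<b} (visited k x) (y, c) = 1"
proof -
  let ?I = "{s. k \<le> snd s x}"
  have "step_closed {a<..<b} ?I" using assms(2) by (auto simp: step_closed_def)
  from exit_mean_cong_on[OF assms(1) this, where s = "(y, c)" and f = "visited k x" and g = "\<lambda>_. 1" and B = 1 and B' = 1]
  show ?thesis using assms by (simp add: exit_mean_const)
qed

text \<open>A walk standing at \<open>x\<close> eats the next cookie of \<open>x\<close> whichever
  way it jumps, and counts never decrease afterwards.\<close>

lemma exit_mean_visited_step:
  assumes "right_drift \<omega>" "x \<in> {a<..<b}" "k = Suc (c x)"
  shows "exit_mean \<omega> {a<..<b} (visited k x) (x, c) = 1"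
  using assms by (subst exit_mean_step[where B = 1]) (auto simp: exit_mean_visited_eq_1)

text \<open>Stop the walk at its first arrival at 0 or \<open>x\<close>. Until then the count of
  \<open>x\<close> is 0; from \<open>x\<close> the first cookie is eaten at once, and from 0 it
  never is.\<close>

lemma visited_once:
  assumes "right_drift \<omega>" "0 < x" "x < K"
  shows "exit_mean \<omega> {0<..<K} (visited (Suc 0) x) (1, \<lambda>_. 0) = hit \<omega> 0 x"
proof -
  let ?G = "exit_mean \<omega> {0<..<K} (visited (Suc 0) x)"
  let ?I = "{s :: int \<times> (int \<Rightarrow> nat). 0 \<le> fst s \<and> fst s \<le> x \<and> snd s x = 0}"
  have I: "step_closed {0<..<x} ?I" by (auto simp: step_closed_def)
  have "exit_mean \<omega> {0<..<x} ?G (1, \<lambda>_. 0) = exit_mean \<omega> {0<..<x} (reach x) (1, \<lambda>_. 0)"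
  proof (rule exit_mean_cong_on[OF assms(1) I, where B = 1 and B' = 1])
    fix s :: "int \<times> (int \<Rightarrow> nat)" assume s: "s \<in> ?I" "fst s \<notin> {0<..<x}"
    then obtain c where "s = (0, c) \<or> s = (x, c)" "c x = 0" by (cases s) force
    then show "?G s = reach x s"
      using assms by (auto simp: exit_mean_outside exit_mean_visited_step)
  qed (use assms in \<open>auto intro: exit_mean_abs_le\<close>)
  also have "exit_mean \<omega> {0<..<x} ?G = ?G"
    by (rule exit_mean_tower[where B = 1]) (use assms in auto)
  finally show ?thesis by (simp add: hit_def)
qed

text \<open>Having jumped right from \<open>x\<close>, the walk eats the second cookie exactly if it
  returns to \<open>x\<close> before \<open>K\<close>. The sites beyond \<open>x\<close> are fresh
  and the counts elsewhere are not read, so the complementary event has probability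
  \<open>hit \<omega> x K\<close>.\<close>

lemma return_from_right:
  assumes "right_drift \<omega>" "0 < x" "x < K" "c x = 1" "\<And>z. x < z \<Longrightarrow> c z = 0"
  shows "exit_mean \<omega> {0<..<K} (visited 2 x) (x + 1, c) = 1 - hit \<omega> x K"
proof -
  let ?G = "exit_mean \<omega> {0<..<K} (visited 2 x)"
  let ?I = "{s :: int \<times> (int \<Rightarrow> nat). x \<le> fst s \<and> fst s \<le> K \<and> snd s x = 1}"
  have I: "step_closed {x<..<K} ?I" by (auto simp: step_closed_def)
  have "exit_mean \<omega> {x<..<K} ?G (x + 1, c) = exit_mean \<omega> {x<..<K} (\<lambda>s. 1 + - 1 * reach K s) (x + 1, c)"
  proof (rule exit_mean_cong_on[OF assms(1) I, where B = 1 and B' = 1])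
    fix s :: "int \<times> (int \<Rightarrow> nat)" assume s: "s \<in> ?I" "fst s \<notin> {x<..<K}"
    then obtain c where "s = (x, c) \<or> s = (K, c)" "c x = 1" by (cases s) force
    then show "?G s = 1 + - 1 * reach K s"
      using assms by (auto simp: exit_mean_outside exit_mean_visited_step)
  qed (use assms in \<open>auto intro: exit_mean_abs_le\<close>)
  also have "\<dots> = 1 + - 1 * exit_mean \<omega> {x<..<K} (reach K) (x + 1, c)"
    using exit_mean_cmult[OF assms(1), where B = 1 and k = "- 1" and f = "reach K"]
    by (subst exit_mean_add[OF assms(1), where B = 1 and B' = 1]) (auto simp: exit_mean_const)
  also have "exit_mean \<omega> {x<..<K} (reach K) (x + 1, c) = hit \<omega> x K"
    unfolding hit_def
    using exit_mean_reach_shift[of x K \<omega> \<omega> 0 c "\<lambda>_. 0" "x + 1"] assms(5) by simp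
  also have "exit_mean \<omega> {x<..<K} ?G = ?G"
    by (rule exit_mean_tower[where B = 1]) (use assms in auto)
  finally show ?thesis by simp
qed

text \<open>The sites left of \<open>x\<close> are already partly consumed, so there is no fresh
  start and no exact formula. The bound for nonnegative drift holds for every history and gives
  \<open>(x - 1) / x\<close> from below.\<close>

lemma return_from_left:
  assumes "right_drift \<omega>" "0 < x" "x < K" "c x = 1"
  shows "1 - 1 / of_int x \<le> exit_mean \<omega> {0<..<K} (visited 2 x) (x - 1, c)"
    and "exit_mean \<omega> {0<..<K} (visited 2 x) (x - 1, c) \<le> 1"
proof -
  let ?G = "exit_mean \<omega> {0<..<K} (visited 2 x)"
  let ?I = "{s :: int \<times> (int \<Rightarrow> nat). 0 \<le> fst s \<and> fst s \<le> x \<and> snd s x = 1}"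
  have I: "step_closed {0<..<x} ?I" by (auto simp: step_closed_def)
  have "exit_mean \<omega> {0<..<x} ?G (x - 1, c) = exit_mean \<omega> {0<..<x} (reach x) (x - 1, c)"
  proof (rule exit_mean_cong_on[OF assms(1) I, where B = 1 and B' = 1])
    fix s :: "int \<times> (int \<Rightarrow> nat)" assume s: "s \<in> ?I" "fst s \<notin> {0<..<x}"
    then obtain c where "s = (0, c) \<or> s = (x, c)" "c x = 1" by (cases s) force
    then show "?G s = reach x s"
      using assms by (auto simp: exit_mean_outside exit_mean_visited_step)
  qed (use assms in \<open>auto intro: exit_mean_abs_le\<close>)
  also have "exit_mean \<omega> {0<..<x} ?G = ?G"
    by (rule exit_mean_tower[where B = 1]) (use assms in auto)
  finally have eq: "?G (x - 1, c) = exit_mean \<omega> {0<..<x} (reach x) (x - 1, c)" .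
  show "?G (x - 1, c) \<le> 1" by (simp add: eq exit_mean_reach_bounds[OF assms(1)])
  have "1 - 1 / of_int x = (of_int (x - 1) / of_int x :: real)" using assms by (simp add: field_simps)
  also have "\<dots> \<le> ?G (x - 1, c)"
    unfolding eq by (rule reach_prob_ge) (use assms in auto)
  finally show "1 - 1 / of_int x \<le> ?G (x - 1, c)" .
qed

text \<open>Split at the first arrival at \<open>x\<close> according to the jump made with the first
  cookie. \<open>R\<close> is the probability of jumping right and then returning; a jump to the
  left returns with probability between \<open>1 - 1 / x\<close> and 1.\<close>

lemma visited_twice:
  assumes "right_drift \<omega>" "0 < x" "x < K"
  defines "R \<equiv> \<omega> x 0 * (1 - hit \<omega> x K)"
  shows "(R + (1 - \<omega> x 0) * (1 - 1 / of_int x)) * hit \<omega> 0 x \<le> exit_mean \<omega> {0<..<K} (visited 2 x) (1, \<lambda>_. 0)"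
    and "exit_mean \<omega> {0<..<K} (visited 2 x) (1, \<lambda>_. 0) \<le> (R + (1 - \<omega> x 0)) * hit \<omega> 0 x"
proof -
  let ?G = "exit_mean \<omega> {0<..<K} (visited 2 x)"
  let ?lo = "R + (1 - \<omega> x 0) * (1 - 1 / of_int x)" and ?hi = "R + (1 - \<omega> x 0)"
  \<comment> \<open>Before the first arrival at \<open>x\<close> every site from \<open>x\<close> on
    is fresh, which is what the return from the right requires.\<close>
  let ?I = "{s :: int \<times> (int \<Rightarrow> nat). 0 \<le> fst s \<and> fst s \<le> x \<and> (\<forall>z\<ge>x. snd s z = 0)}"
  have I: "step_closed {0<..<x} ?I" by (auto simp: step_closed_def)
  have w: "0 \<le> \<omega> x 0" "0 \<le> 1 - \<omega> x 0" using right_driftD[OF assms(1)] by auto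
  have out: "?lo * reach x s \<le> ?G s \<and> ?G s \<le> ?hi * reach x s"
    if s: "s \<in> ?I" "fst s \<notin> {0<..<x}" for s
  proof -
    obtain y c where yc: "s = (y, c)" by (cases s)
    with s have c: "\<And>z. z \<ge> x \<Longrightarrow> c z = 0" and y: "y = 0 \<or> y = x" by auto
    have c': "exit_mean \<omega> {0<..<K} (visited 2 x) (x + 1, c(x := 1)) = 1 - hit \<omega> x K"
      by (rule return_from_right) (use assms c in auto)
    have "1 - 1 / of_int x \<le> ?G (x - 1, c(x := 1))" "?G (x - 1, c(x := 1)) \<le> 1"
      by (rule return_from_left; use assms in simp)+
    moreover have "?G (x, c) = R + (1 - \<omega> x 0) * ?G (x - 1, c(x := 1))"
      using assms(2,3) c by (subst exit_mean_step[OF assms(1), where B = 1]) (auto simp: c'[simplified] R_def)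
    ultimately show ?thesis
      using y w assms(2,3) yc c[of x] mult_left_mono[OF _ w(2), of "1 - 1 / of_int x" "?G (x - 1, c(x := 1))"]
        mult_left_mono[OF _ w(2), of "?G (x - 1, c(x := 1))" 1]
      by (auto simp: exit_mean_outside)
  qed
  have G: "exit_mean \<omega> {0<..<x} ?G = ?G"
    by (rule exit_mean_tower[where B = 1]) (use assms in auto)
  have R: "exit_mean \<omega> {0<..<x} (\<lambda>s. k * reach x s) (1, \<lambda>_. 0) = k * hit \<omega> 0 x" for k
    by (simp add: hit_def exit_mean_cmult[OF assms(1), where B = 1])
  have "exit_mean \<omega> {0<..<x} (\<lambda>s. ?lo * reach x s) (1, \<lambda>_. 0) \<le> exit_mean \<omega> {0<..<x} ?G (1, \<lambda>_. 0)"
    by (rule exit_mean_mono_on[OF assms(1) I, where B = "\<bar>?lo\<bar>" and B' = 1])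
       (use assms out in \<open>auto intro: exit_mean_abs_le\<close>)
  then show "?lo * hit \<omega> 0 x \<le> ?G (1, \<lambda>_. 0)" by (simp add: R G)
  have "exit_mean \<omega> {0<..<x} ?G (1, \<lambda>_. 0) \<le> exit_mean \<omega> {0<..<x} (\<lambda>s. ?hi * reach x s) (1, \<lambda>_. 0)"
    by (rule exit_mean_mono_on[OF assms(1) I, where B = 1 and B' = "\<bar>?hi\<bar>"])
       (use assms out in \<open>auto intro: exit_mean_abs_le\<close>)
  then show "?G (1, \<lambda>_. 0) \<le> ?hi * hit \<omega> 0 x" by (simp add: R G)
qed

text \<open>Inserts the visit probabilities into the drift identity. The product in \<open>T\<close>
  is the drift of the second cookie lost when the walk jumps right and reaches \<open>K\<close>;
  losing it on the left costs at most \<open>hit \<omega> 0 x / x\<close>.\<close>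

lemma hit_recursion:
  assumes "right_drift \<omega>" "0 < K" "\<And>x k. 0 < x \<Longrightarrow> x < K \<Longrightarrow> 2 \<le> k \<Longrightarrow> \<omega> x k = 1/2"
  defines "T \<equiv> \<lambda>x. (2 * \<omega> x 0 - 1) * hit \<omega> 0 x + (2 * \<omega> x (Suc 0) - 1) * hit \<omega> 0 x
                   - (2 * \<omega> x (Suc 0) - 1) * \<omega> x 0 * hit \<omega> 0 x * hit \<omega> x K"
  shows "1 + (\<Sum>x\<in>{0<..<K}. T x - hit \<omega> 0 x / of_int x) \<le> of_int K * hit \<omega> 0 K"
    and "of_int K * hit \<omega> 0 K \<le> 1 + (\<Sum>x\<in>{0<..<K}. T x)"
proof -
  let ?W = "\<lambda>x. exit_mean \<omega> {0<..<K} (visited 2 x) (1, \<lambda>_. 0)"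
  have eq: "of_int K * hit \<omega> 0 K = 1 + (\<Sum>x\<in>{0<..<K}. (2 * \<omega> x 0 - 1) * hit \<omega> 0 x + (2 * \<omega> x (Suc 0) - 1) * ?W x)"
    using hit_drift_identity[OF assms(1-3)] visited_once[OF assms(1)] by simp
  have b: "T x - hit \<omega> 0 x / of_int x \<le> (2 * \<omega> x 0 - 1) * hit \<omega> 0 x + (2 * \<omega> x (Suc 0) - 1) * ?W x
      \<and> (2 * \<omega> x 0 - 1) * hit \<omega> 0 x + (2 * \<omega> x (Suc 0) - 1) * ?W x \<le> T x"
    if x: "x \<in> {0<..<K}" for x
  proof -
    let ?v = "hit \<omega> 0 x" and ?w = "\<omega> x 0" and ?d = "2 * \<omega> x (Suc 0) - 1" and ?h = "hit \<omega> x K"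
    have w: "0 \<le> 1 - ?w" "1 - ?w \<le> 1" and d: "0 \<le> ?d" "?d \<le> 1" and v: "0 \<le> ?v"
      using right_driftD[OF assms(1), of x 0] right_driftD[OF assms(1), of x 1] hit_bounds[OF assms(1), of 0 x] by auto
    have "?d * ?W x \<le> ?d * ((?w * (1 - ?h) + (1 - ?w)) * ?v)"
      using visited_twice(2)[OF assms(1), of x K] x d by (intro mult_left_mono) auto
    moreover have "?d * ((?w * (1 - ?h) + (1 - ?w) * (1 - 1 / of_int x)) * ?v) \<le> ?d * ?W x"
      using visited_twice(1)[OF assms(1), of x K] x d by (intro mult_left_mono) auto
    moreover have "?d * (1 - ?w) * (?v / of_int x) \<le> 1 * (?v / of_int x)"
      using w d v x by (intro mult_right_mono mult_le_one) auto
    ultimately show ?thesis unfolding T_def by (simp add: algebra_simps add_divide_distrib diff_divide_distrib)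
  qed
  show "1 + (\<Sum>x\<in>{0<..<K}. T x - hit \<omega> 0 x / of_int x) \<le> of_int K * hit \<omega> 0 K"
    unfolding eq using b by (intro add_left_mono sum_mono) blast
  show "of_int K * hit \<omega> 0 K \<le> 1 + (\<Sum>x\<in>{0<..<K}. T x)"
    unfolding eq using b by (intro add_left_mono sum_mono) blast
qed

section \<open>From finite intervals to survival on the half-line\<close>

lemma hit_antimono:
  assumes "right_drift \<omega>" "0 < K" "K \<le> L"
  shows "hit \<omega> 0 L \<le> hit \<omega> 0 K"
proof -
  \<comment> \<open>Stop at the exit from the shorter interval: a walk that ends in 0 there can no
    longer reach \<open>L\<close>.\<close>
  have "exit_mean \<omega> {0<..<L} (reach L) = exit_mean \<omega> {0<..<K} (exit_mean \<omega> {0<..<L} (reach L))"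
    by (rule exit_mean_tower[where B = 1, symmetric]) (use assms in auto)
  moreover have "exit_mean \<omega> {0<..<K} (exit_mean \<omega> {0<..<L} (reach L)) (1, \<lambda>_. 0)
      \<le> exit_mean \<omega> {0<..<K} (reach K) (1, \<lambda>_. 0)"
  proof (rule exit_mean_mono_on[OF assms(1) step_closed_UNIV UNIV_I, where B = 1 and B' = 1])
    fix s :: "int \<times> (int \<Rightarrow> nat)" assume "fst s \<notin> {0<..<K}"
    then show "exit_mean \<omega> {0<..<L} (reach L) s \<le> reach K s"
      using exit_mean_reach_bounds[OF assms(1), of 0 L L s] assms
      by (cases "fst s \<le> 0") (auto simp: exit_mean_outside)
  qed (use assms in \<open>auto intro: exit_mean_abs_le\<close>)
  ultimately show ?thesis by (simp add: hit_def)
qed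

abbreviation survive :: "env \<Rightarrow> nat \<Rightarrow> int \<times> (int \<Rightarrow> nat) \<Rightarrow> real" where
  "survive \<omega> n \<equiv> stop_iter \<omega> {0<..} n (reach 1)"

lemma survive_le_1: "right_drift \<omega> \<Longrightarrow> survive \<omega> n s \<le> 1"
  and survive_ge_0: "right_drift \<omega> \<Longrightarrow> 0 \<le> survive \<omega> n s"
  using stop_iter_mono_on[OF _ step_closed_UNIV, where f = "reach 1" and g = "\<lambda>_. 1" and D = "{0<..}"]
    stop_iter_mono_on[OF _ step_closed_UNIV, where g = "reach 1" and f = "\<lambda>_. 0" and D = "{0<..}"]
  by (auto simp: stop_iter_harmonic[OF stop_op_const])

text \<open>A walk frozen on leaving the positive half-line is positive at time \<open>n\<close>
  exactly if it was positive all along, so one more step can only lower the probability.\<close>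

lemma survive_decseq:
  assumes "right_drift \<omega>"
  shows "decseq (\<lambda>n. survive \<omega> n s)"
proof (rule decseq_SucI)
  fix n
  have "survive \<omega> 1 s \<le> survive \<omega> 0 s" for s
  proof (cases "fst s > 0")
    case True
    then show ?thesis using survive_le_1[OF assms, of 1 s] by simp
  qed (simp add: stop_op_outside)
  then have "stop_iter \<omega> {0<..} n (survive \<omega> 1) s \<le> stop_iter \<omega> {0<..} n (survive \<omega> 0) s"
    by (intro stop_iter_mono_on[OF assms step_closed_UNIV]) auto
  then show "survive \<omega> (Suc n) s \<le> survive \<omega> n s"
    by (simp add: funpow_swap1)
qed

text \<open>From \<open>y\<close> at least \<open>K - y\<close> steps are needed to reach
  \<open>K\<close>, so reaching it before 0 entails staying positive for \<open>n\<close>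
  steps.\<close>

lemma hit_le_survive:
  assumes "right_drift \<omega>" "0 < K" "y + int n \<le> K"
  shows "exit_mean \<omega> {0<..<K} (reach K) (y, c) \<le> survive \<omega> n (y, c)"
  using assms(3)
proof (induction n arbitrary: y c)
  case 0
  then show ?case
    using assms(2) exit_mean_reach_bounds[OF assms(1), of 0 K K "(y, c)"]
    by (cases "y \<ge> 1") (auto simp: exit_mean_outside)
next
  case (Suc n)
  show ?case
  proof (cases "y > 0")
    case True
    then have y: "y \<in> {0<..<K}" "y \<in> {0<..}" using Suc.prems by auto
    have w: "0 \<le> \<omega> y (c y)" "0 \<le> 1 - \<omega> y (c y)" using right_driftD[OF assms(1)] by auto
    show ?thesis
      unfolding stop_iter_inside[OF y(2)]
      by (subst exit_mean_step[OF assms(1) _ y(1), where B = 1])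
         (use Suc.prems w in \<open>auto intro!: add_mono mult_left_mono Suc.IH\<close>)
  next
    case False
    then show ?thesis using assms(2) by (subst stop_iter_outside) (auto simp: exit_mean_outside)
  qed
qed

text \<open>The limit \<open>S\<close> is harmonic, hence equal to its own exit mean from the
  interval. It vanishes at nonpositive positions and is at most 1 elsewhere, so it lies below
  \<open>reach K\<close> at the exit.\<close>

lemma survive_limit_le_hit:
  assumes "right_drift \<omega>" "\<And>s. (\<lambda>n. survive \<omega> n s) \<longlonglongrightarrow> S s" "0 < K"
  shows "S (1, \<lambda>_. 0) \<le> hit \<omega> 0 K"
proof -
  have b: "0 \<le> S s" "S s \<le> 1" for s
    using LIMSEQ_le_const[OF assms(2)] LIMSEQ_le_const2[OF assms(2)] survive_ge_0[OF assms(1)] survive_le_1[OF assms(1)]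
    by blast+
  have "stop_op \<omega> {0<..<K} S = S"
  proof
    fix s :: "int \<times> (int \<Rightarrow> nat)"
    obtain y c where s: "s = (y, c)" by (cases s)
    show "stop_op \<omega> {0<..<K} S s = S s"
    proof (cases "y \<in> {0<..<K}")
      case True
      then have y: "y \<in> {0<..}" by auto
      have "(\<lambda>n. survive \<omega> (Suc n) (y, c)) \<longlonglongrightarrow> stop_op \<omega> {0<..<K} S (y, c)"
        using True by (subst stop_iter_inside[OF y]) (auto simp: stop_op_def intro!: tendsto_add tendsto_mult_left assms(2))
      from LIMSEQ_unique[OF this LIMSEQ_Suc[OF assms(2)]] show ?thesis by (simp add: s)
    qed (simp add: stop_op_outside s)
  qed
  then have "S (1, \<lambda>_. 0) = exit_mean \<omega> {0<..<K} S (1, \<lambda>_. 0)" by (simp add: exit_mean_harmonic)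
  also have "\<dots> \<le> exit_mean \<omega> {0<..<K} (reach K) (1, \<lambda>_. 0)"
  proof (rule exit_mean_mono_on[OF assms(1) step_closed_UNIV UNIV_I, where B = 1 and B' = 1])
    fix s :: "int \<times> (int \<Rightarrow> nat)" assume s: "fst s \<notin> {0<..<K}"
    show "S s \<le> reach K s"
    proof (cases "fst s \<le> 0")
      case True
      then have "(\<lambda>n. survive \<omega> n s) = (\<lambda>_. 0)" by (intro ext, subst stop_iter_outside) auto
      with assms(2)[of s] have "S s = 0" by (simp add: LIMSEQ_const_iff)
      then show ?thesis by simp
    qed (use s b in auto)
  qed (use b in auto)
  finally show ?thesis by (simp add: hit_def)
qed

lemma hit_and_survive_same_limit:
  assumes "right_drift \<omega>"
  obtains S where "(\<lambda>n. survive \<omega> n (1, \<lambda>_. 0)) \<longlonglongrightarrow> S" "(\<lambda>K. hit \<omega> 0 (int K)) \<longlonglongrightarrow> S"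
proof -
  have "\<exists>L. (\<lambda>n. survive \<omega> n s) \<longlonglongrightarrow> L" for s
    using decseq_convergent[OF survive_decseq[OF assms]] survive_ge_0[OF assms] by metis
  then obtain S where S: "\<And>s. (\<lambda>n. survive \<omega> n s) \<longlonglongrightarrow> S s" by metis
  have "(\<lambda>K. hit \<omega> 0 (int K)) \<longlonglongrightarrow> S (1, \<lambda>_. 0)"
  \<comment> \<open>The upper bound uses \<open>K - 1\<close> steps because the walk starts at
    1.\<close>
  proof (rule tendsto_sandwich[of "\<lambda>_. S (1, \<lambda>_. 0)" _ _ "\<lambda>K. survive \<omega> (K - 1) (1, \<lambda>_. 0)"])
    show "eventually (\<lambda>K. S (1, \<lambda>_. 0) \<le> hit \<omega> 0 (int K)) sequentially"
      using eventually_gt_at_top[of "0::nat"] by (rule eventually_mono) (simp add: survive_limit_le_hit[OF assms S])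
    show "eventually (\<lambda>K. hit \<omega> 0 (int K) \<le> survive \<omega> (K - 1) (1, \<lambda>_. 0)) sequentially"
      using eventually_gt_at_top[of "0::nat"] by (rule eventually_mono) (simp add: hit_def hit_le_survive[OF assms])
    show "(\<lambda>K. survive \<omega> (K - 1) (1, \<lambda>_. 0)) \<longlonglongrightarrow> S (1, \<lambda>_. 0)"
      by (rule LIMSEQ_imp_Suc) (simp add: S)
  qed auto
  with S that show ?thesis by blast
qed

section \<open>The limit of the renewal-type recursion\<close>

lemma cesaro_null:
  fixes f :: "nat \<Rightarrow> real"
  assumes "f \<longlonglongrightarrow> 0" "\<And>x. 0 \<le> f x"
  shows "(\<lambda>n. (\<Sum>x<n. f x) / real n) \<longlonglongrightarrow> 0"
proof (rule LIMSEQ_I)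
  fix e :: real assume e: "e > 0"
  obtain N where N: "\<And>x. x \<ge> N \<Longrightarrow> f x < e / 2"
    using order_tendstoD(2)[OF assms(1), of "e / 2"] e by (auto simp: eventually_sequentially)
  let ?C = "\<Sum>x<N. f x"
  obtain n0 :: nat where n0: "real n0 > 2 * ?C / e" using reals_Archimedean2 by blast
  have "norm ((\<Sum>x<n. f x) / real n - 0) < e" if n: "n \<ge> max (Suc n0) N" for n
  proof -
    have "(\<Sum>x<n. f x) = ?C + (\<Sum>x\<in>{N..<n}. f x)"
      using n by (subst sum.union_disjoint[symmetric]) (auto intro: sum.cong)
    also have "(\<Sum>x\<in>{N..<n}. f x) \<le> (\<Sum>x\<in>{N..<n}. e / 2)"
      by (rule sum_mono) (use N in \<open>auto intro: less_imp_le\<close>)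
    also have "\<dots> \<le> real n * (e / 2)" using e by simp
    also have "2 * ?C < e * real n" using n0 n e by (simp add: field_simps) (smt (verit) mult_left_mono of_nat_le_iff Suc_leD)
    then have "?C + real n * (e / 2) < real n * e" by (simp add: field_simps)
    finally have "(\<Sum>x<n. f x) < real n * e" by simp
    moreover have "0 \<le> (\<Sum>x<n. f x)" by (rule sum_nonneg) (rule assms(2))
    ultimately show ?thesis using n by (simp add: field_simps)
  qed
  then show "\<exists>no. \<forall>n\<ge>no. norm ((\<Sum>x<n. f x) / real n - 0) < e" by blast
qed

lemma harmonic_partial_sums_unbounded:
  fixes N :: nat and C :: real
  assumes "N > 0"
  obtains n where "C < (\<Sum>i<n. 1 / real (i + N))"
proof (rule ccontr)
  assume "\<not> thesis"
  then have "(\<Sum>i<n. 1 / real (i + N)) \<le> C" for n using that[of n] by (meson not_le)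
  then have "summable (\<lambda>i. 1 / real (i + N))"
    by (intro summableI_nonneg_bounded[of _ C]) auto
  then have "summable (\<lambda>i. inverse (real i))"
    by (subst summable_iff_shift[of _ N, symmetric]) (simp add: inverse_eq_divide)
  then show False using not_summable_harmonic[where 'a = real] by simp
qed

text \<open>If \<open>p\<close> vanished in the limit, the middle terms of the lower sum would contribute at least
  \<open>(1 + \<eta>) p x\<close> each, too much because \<open>K * p K\<close> is at most the sum of the \<open>p x\<close>.\<close>
lemma renewal_limit_pos:
  fixes p :: "nat \<Rightarrow> real"
  assumes bounds: "\<And>n. 0 \<le> p n" "\<And>n. p n \<le> 1" and anti: "\<And>m n. 0 < m \<Longrightarrow> m \<le> n \<Longrightarrow> p n \<le> p m"
    and ge: "\<And>n. 0 < n \<Longrightarrow> 1 / real n \<le> p n" and "0 < a" "1 < d"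
    and lo: "\<And>K. 0 < K \<Longrightarrow> 1 + (\<Sum>x\<in>{0<..<K}. p x * (d - a * p (K - x)) - p x / real x) \<le> real K * p K"
  shows "\<not> p \<longlonglongrightarrow> 0"
proof
  assume lim: "p \<longlonglongrightarrow> 0"
  \<comment> \<open>A third of the excess \<open>d - 1\<close> is given up to
    \<open>a * p (K - x)\<close> and another third to \<open>1 / x\<close>; the last one remains as
    gain.\<close>
  define \<eta> where "\<eta> = (d - 1) / 3"
  have "\<eta> * 3 = d - 1" by (simp add: \<eta>_def)
  then have \<eta>: "\<eta> > 0" "d = 1 + 3 * \<eta>" using \<open>1 < d\<close> by linarith+
  have "eventually (\<lambda>x. p x < \<eta> / a) sequentially"
    using lim \<eta> \<open>0 < a\<close> by (intro order_tendstoD) auto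
  moreover have "eventually (\<lambda>x. 1 / real x < \<eta>) sequentially"
    using lim_1_over_n \<eta> by (intro order_tendstoD) auto
  ultimately have "eventually (\<lambda>x. p x < \<eta> / a \<and> 1 / real x < \<eta>) sequentially"
    by (rule eventually_conj)
  then obtain N0 where N0: "\<And>x. x \<ge> N0 \<Longrightarrow> p x < \<eta> / a \<and> 1 / real x < \<eta>"
    unfolding eventually_sequentially by blast
  define N where "N = Suc N0"
  have N: "\<And>x. x \<ge> N \<Longrightarrow> p x < \<eta> / a" "\<And>x. x \<ge> N \<Longrightarrow> 1 / real x < \<eta>" "N > 0"
    using N0 by (simp_all add: N_def)
  have N1: "a * p x < \<eta>" if "x \<ge> N" for x using N(1)[OF that] \<open>0 < a\<close> by (simp add: field_simps)
  obtain n where n: "(2 * real N * (a + 2)) / \<eta> < (\<Sum>i<n. 1 / real (i + N))"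
    using harmonic_partial_sums_unbounded[OF N(3)] by blast
  \<comment> \<open>With this \<open>K\<close>, every \<open>x\<close> in the block
    \<open>?B\<close> has both \<open>x\<close> and \<open>K - x\<close> at least \<open>N\<close>,
    and at most \<open>2 * N\<close> indices lie outside the block.\<close>
  define K where "K = n + 2 * N"
  have K: "K > 0" using N by (simp add: K_def)
  let ?B = "{N..<N + n}"
  define S where "S = (\<Sum>x\<in>?B. p x)"
  have B: "?B \<subseteq> {0<..<K}" using N by (auto simp: K_def)
  have term_ge: "(if x \<in> ?B then (1 + \<eta>) * p x else - (a + 1)) \<le> p x * (d - a * p (K - x)) - p x / real x"
    if x: "x \<in> {0<..<K}" for x
  proof (cases "x \<in> ?B")
    case True
    then have "N \<le> K - x" "N \<le> x" by (auto simp: K_def)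
    then have "1 + \<eta> \<le> d - a * p (K - x) - 1 / real x"
      using N1[of "K - x"] N(2)[of x] \<eta> by linarith
    then have "p x * (1 + \<eta>) \<le> p x * (d - a * p (K - x) - 1 / real x)"
      by (rule mult_left_mono) (rule bounds)
    then show ?thesis using True by (simp add: algebra_simps)
  next
    case False
    have "a * p (K - x) \<le> a" using bounds(2)[of "K - x"] \<open>0 < a\<close> by simp
    moreover have "1 / real x \<le> 1" using x by simp
    ultimately have "- (a + 1) \<le> d - a * p (K - x) - 1 / real x" using \<open>1 < d\<close> by linarith
    then have "p x * - (a + 1) \<le> p x * (d - a * p (K - x) - 1 / real x)"
      by (rule mult_left_mono) (rule bounds)
    moreover have "1 * - (a + 1) \<le> p x * - (a + 1)"
      using bounds(2)[of x] \<open>0 < a\<close> by (intro mult_right_mono_neg) auto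
    ultimately show ?thesis unfolding if_not_P[OF False] by (simp add: algebra_simps)
  qed
  have "card ({0<..<K} - ?B) = K - 1 - n" by (subst card_Diff_subset) (use B in auto)
  then have card: "card ({0<..<K} - ?B) \<le> 2 * N" by (simp add: K_def)
  have "(1 + \<eta>) * S - 2 * real N * (a + 1) \<le> (1 + \<eta>) * S - real (card ({0<..<K} - ?B)) * (a + 1)"
    using card \<open>0 < a\<close> by (intro diff_left_mono mult_right_mono) auto
  also have "\<dots> = (\<Sum>x\<in>{0<..<K}. if x \<in> ?B then (1 + \<eta>) * p x else - (a + 1))"
    using B by (subst sum.If_cases) (simp_all add: Int_absorb1 Diff_eq[symmetric] S_def sum_distrib_left
        del: minus_add_distrib atLeastLessThan_iff Collect_conj_eq)
  also have "\<dots> \<le> (\<Sum>x\<in>{0<..<K}. p x * (d - a * p (K - x)) - p x / real x)"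
    by (rule sum_mono) (rule term_ge)
  also have "\<dots> \<le> real K * p K" using lo[OF K] by simp
  also have "\<dots> = real n * p K + 2 * real N * p K" by (simp add: K_def algebra_simps)
  \<comment> \<open>Monotonicity bounds \<open>p K\<close> by each of the \<open>n\<close> terms in
    the block. The surplus \<open>\<eta> * S\<close> is then bounded by boundary terms, against the
    choice of \<open>n\<close> from the divergent harmonic series.\<close>
  also have "real n * p K \<le> S"
    using sum_mono[of ?B "\<lambda>_. p K" p] anti N(3) by (auto simp: S_def K_def)
  also have "2 * real N * p K \<le> 2 * real N * 1" using bounds by (intro mult_left_mono) auto
  finally have "\<eta> * S \<le> 2 * real N * (a + 2)" by (simp add: algebra_simps)
  then have "S \<le> (2 * real N * (a + 2)) / \<eta>" using \<eta> by (simp add: field_simps)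
  also note n
  also have "(\<Sum>i<n. 1 / real (i + N)) \<le> (\<Sum>i<n. p (i + N))"
    by (rule sum_mono) (rule ge, simp add: N)
  also have "\<dots> = S"
    unfolding S_def by (rule sum.reindex_bij_witness[of _ "\<lambda>x. x - N" "\<lambda>i. i + N"]) auto
  finally show False by simp
qed

text \<open>Divided by \<open>K\<close>, both bounds turn into Cesaro means and force
  \<open>l = l * (d - a * l)\<close>. A nonzero root is \<open>(d - 1) / a\<close>, and it requires
  \<open>d > 1\<close> because \<open>l\<close> is nonnegative; for \<open>d > 1\<close> the root 0
  is excluded by \<open>renewal_limit_pos\<close>.\<close>

lemma renewal_limit:
  fixes p :: "nat \<Rightarrow> real"
  assumes bounds: "\<And>n. 0 \<le> p n" "\<And>n. p n \<le> 1" and anti: "\<And>m n. 0 < m \<Longrightarrow> m \<le> n \<Longrightarrow> p n \<le> p m"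
    and ge: "\<And>n. 0 < n \<Longrightarrow> 1 / real n \<le> p n" and a: "0 < a"
    and lo: "\<And>K. 0 < K \<Longrightarrow> 1 + (\<Sum>x\<in>{0<..<K}. p x * (d - a * p (K - x)) - p x / real x) \<le> real K * p K"
    and hi: "\<And>K. 0 < K \<Longrightarrow> real K * p K \<le> 1 + (\<Sum>x\<in>{0<..<K}. p x * (d - a * p (K - x)))"
    and lim: "p \<longlonglongrightarrow> l"
  shows "l = max (d - 1) 0 / a"
proof -
  have l0: "0 \<le> l" using LIMSEQ_le_const[OF lim] bounds by blast
  have pl: "l \<le> p m" if "0 < m" for m
    by (rule LIMSEQ_le_const2[OF lim]) (use anti that in blast)
  have l1: "l \<le> 1" using LIMSEQ_le_const2[OF lim] bounds by blast
  \<comment> \<open>Dominates the error of replacing the summand by its limit: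
    \<open>\<bar>d\<bar> + a\<close> comes from \<open>p x\<close>, another \<open>a\<close> from
    \<open>p (K - x)\<close> after reflecting the sum, and \<open>1 / x\<close> from the lower
    bound. The value 0 at \<open>x = 0\<close> allows summation over all
    \<open>x < K\<close>.\<close>
  define e where "e x = (if x = 0 then 0 else (\<bar>d\<bar> + 2 * a) * (p x - l) + 1 / real x)" for x
  have e0: "0 \<le> e x" for x using pl[of x] a by (auto simp: e_def)
  have "e \<longlonglongrightarrow> 0"
  proof (rule Lim_transform_eventually)
    show "(\<lambda>x. (\<bar>d\<bar> + 2 * a) * (p x - l) + 1 / real x) \<longlonglongrightarrow> 0"
      using tendsto_add[OF tendsto_mult_left[OF tendsto_diff[OF lim tendsto_const[of l]], of "\<bar>d\<bar> + 2 * a"] lim_1_over_n]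
      by simp
    show "eventually (\<lambda>x. (\<bar>d\<bar> + 2 * a) * (p x - l) + 1 / real x = e x) sequentially"
      using eventually_gt_at_top[of "0::nat"] by (rule eventually_mono) (simp add: e_def)
  qed
  from cesaro_null[OF this e0] have ces: "(\<lambda>K. (\<Sum>x<K. e x) / real K) \<longlonglongrightarrow> 0" .
  let ?c = "l * (d - a * l)"
  have key: "\<bar>real K * p K - 1 - real (K - 1) * ?c\<bar> \<le> (\<Sum>x<K. e x)" if K: "K > 0" for K
  proof -
    let ?X = "{0<..<K}"
    \<comment> \<open>The reflection of \<open>x\<close> to \<open>K - x\<close> turns the
      convolution error into an ordinary partial sum.\<close>
    have rev: "(\<Sum>x\<in>?X. a * (p (K - x) - l)) = (\<Sum>x\<in>?X. a * (p x - l))"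
      by (rule sum.reindex_bij_witness[of _ "\<lambda>x. K - x" "\<lambda>x. K - x"]) auto
    have d1: "\<bar>p x * (d - a * p (K - x)) - ?c\<bar> \<le> (\<bar>d\<bar> + a) * (p x - l) + a * (p (K - x) - l)"
      if x: "x \<in> ?X" for x
    proof -
      have px: "0 \<le> p x - l" "0 \<le> p (K - x) - l" using pl x by auto
      have "p x * (d - a * p (K - x)) - ?c = d * (p x - l) + (- (a * p (K - x) * (p x - l)) + - (a * l * (p (K - x) - l)))"
        by (simp add: algebra_simps)
      moreover have "\<bar>d * (p x - l)\<bar> = \<bar>d\<bar> * (p x - l)" using px by (simp add: abs_mult)
      moreover have "0 \<le> a * p (K - x) * (p x - l)" "0 \<le> a * l * (p (K - x) - l)"
        using px a l0 bounds by simp_all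
      moreover have "a * p (K - x) * (p x - l) \<le> a * 1 * (p x - l)"
        using px a bounds by (intro mult_right_mono mult_left_mono) auto
      moreover have "a * l * (p (K - x) - l) \<le> a * 1 * (p (K - x) - l)"
        using px a l1 by (intro mult_right_mono mult_left_mono) auto
      ultimately show ?thesis by (simp add: distrib_right abs_le_iff) linarith
    qed
    have "(\<Sum>x<K. e x) = (\<Sum>x\<in>?X. e x)"
      by (rule sum.mono_neutral_right) (auto simp: e_def)
    also have "\<dots> = (\<Sum>x\<in>?X. (\<bar>d\<bar> + a) * (p x - l) + a * (p x - l) + 1 / real x)"
      by (rule sum.cong) (auto simp: e_def algebra_simps)
    also have "\<dots> = (\<Sum>x\<in>?X. (\<bar>d\<bar> + a) * (p x - l) + a * (p (K - x) - l) + 1 / real x)"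
      by (simp only: sum.distrib rev)
    finally have esum: "(\<Sum>x<K. e x) = \<dots>" .
    have cst: "(\<Sum>x\<in>?X. ?c) = real (K - 1) * ?c" by simp
    have "real K * p K - 1 - real (K - 1) * ?c \<le> (\<Sum>x\<in>?X. p x * (d - a * p (K - x)) - ?c)"
      unfolding sum_subtractf cst using hi[OF K] by simp
    also have "\<dots> \<le> (\<Sum>x<K. e x)"
      unfolding esum by (rule sum_mono) (use d1 in \<open>fastforce simp: abs_le_iff intro: add_increasing2\<close>)
    finally have up: "real K * p K - 1 - real (K - 1) * ?c \<le> (\<Sum>x<K. e x)" .
    have "- (\<Sum>x<K. e x) \<le> (\<Sum>x\<in>?X. (p x * (d - a * p (K - x)) - p x / real x) - ?c)"
      unfolding esum sum_negf[symmetric]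
    proof (rule sum_mono)
      fix x assume x: "x \<in> ?X"
      have "p x / real x \<le> 1 / real x" using bounds by (intro divide_right_mono) auto
      then show "- ((\<bar>d\<bar> + a) * (p x - l) + a * (p (K - x) - l) + 1 / real x) \<le> (p x * (d - a * p (K - x)) - p x / real x) - ?c"
        using d1[OF x] by (simp only: abs_le_iff) linarith
    qed
    also have "\<dots> \<le> real K * p K - 1 - real (K - 1) * ?c"
      unfolding sum_subtractf[of _ "\<lambda>_. ?c"] cst using lo[OF K] by simp
    finally show ?thesis using up by (simp add: abs_le_iff)
  qed
  have "(\<lambda>K. p K - 1 / real K - (1 - 1 / real K) * ?c) \<longlonglongrightarrow> 0"
  proof (rule Lim_null_comparison[OF _ ces])
    have bd: "norm (p K - 1 / real K - (1 - 1 / real K) * ?c) \<le> (\<Sum>x<K. e x) / real K" if "K > 0" for K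
    proof -
      have "p K - 1 / real K - (1 - 1 / real K) * ?c = (real K * p K - 1 - real (K - 1) * ?c) / real K"
        using that by (simp add: field_simps of_nat_diff)
      then show ?thesis using divide_right_mono[OF key[OF that], of "real K"] by (simp add: abs_divide)
    qed
    show "eventually (\<lambda>K. norm (p K - 1 / real K - (1 - 1 / real K) * ?c) \<le> (\<Sum>x<K. e x) / real K) sequentially"
      using eventually_gt_at_top[of "0::nat"] by (rule eventually_mono) (rule bd)
  qed
  moreover have "(\<lambda>K. p K - 1 / real K - (1 - 1 / real K) * ?c) \<longlonglongrightarrow> l - 0 - (1 - 0) * ?c"
    by (intro tendsto_intros lim lim_1_over_n)
  ultimately have "l = l * (d - a * l)" using LIMSEQ_unique by fastforce
  then consider "l = 0" | "l \<noteq> 0" "d - 1 = a * l" by force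
  then show ?thesis
  proof cases
    case 1
    have "\<not> 1 < d" using renewal_limit_pos[OF bounds anti ge a _ lo] lim 1 by blast
    then show ?thesis using 1 by simp
  next
    case 2
    then have "0 < d - 1" using l0 a by simp
    then show ?thesis using 2(2) a by simp
  qed
qed

section \<open>Independent sites\<close>

lemma measurable_site_coord: "(\<lambda>v. v k) \<in> borel_measurable site_space"
  unfolding site_space_def by measurable

text \<open>Stated for every index set \<open>J\<close> so that hitting probabilities can be
  regarded as functions of a block of sites. Sites outside \<open>J\<close> carry the fixed value
  \<open>undefined\<close>, hence give constants.\<close>

lemma measurable_cookie: "(\<lambda>\<omega>. \<omega> z k) \<in> borel_measurable (Pi\<^sub>M J (\<lambda>_::int. site_space))"
proof (cases "z \<in> J")
  case True
  from measurable_compose[OF measurable_component_singleton[OF True] measurable_site_coord] show ?thesis .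
next
  case False
  have out: "\<omega> z k = undefined k" if "\<omega> \<in> space (Pi\<^sub>M J (\<lambda>_. site_space))" for \<omega> :: env
  proof -
    have "\<omega> \<in> Pi\<^sub>E J (\<lambda>_. space site_space)" using that by (simp only: space_PiM)
    from PiE_arb[OF this False] show ?thesis by (rule arg_cong)
  qed
  have "(\<lambda>\<omega>. \<omega> z k) \<in> borel_measurable (Pi\<^sub>M J (\<lambda>_. site_space))
      \<longleftrightarrow> (\<lambda>_. undefined k :: real) \<in> borel_measurable (Pi\<^sub>M J (\<lambda>_. site_space))"
    by (rule measurable_cong) (rule out)
  then show ?thesis by simp
qed

lemma measurable_stop_iter: "(\<lambda>\<omega>. stop_iter \<omega> D n f s) \<in> borel_measurable (Pi\<^sub>M J (\<lambda>_. site_space))"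
proof (induction n arbitrary: s)
  case 0
  show ?case unfolding funpow_0 by (rule borel_measurable_const)
next
  case (Suc n)
  obtain y c where s: "s = (y, c)" by (cases s)
  show ?case
  proof (cases "y \<in> D")
    case True
    show ?thesis
      unfolding s stop_iter_inside[OF True]
      by (rule borel_measurable_add; rule borel_measurable_times;
          (rule borel_measurable_diff, rule borel_measurable_const)?; (rule Suc.IH | rule measurable_cookie))
  next
    case False
    then have eq: "stop_iter \<omega> D (Suc n) f s = f s" for \<omega>
      by (intro stop_iter_outside) (simp add: s)
    show ?thesis unfolding eq by (rule borel_measurable_const)
  qed
qed

lemma measurable_hit: "(\<lambda>\<omega>. hit \<omega> a b) \<in> borel_measurable (Pi\<^sub>M J (\<lambda>_. site_space))"
  unfolding hit_def exit_mean_def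
  by (rule borel_measurable_lim_metric) (rule measurable_stop_iter)

locale iid_cookies = prob_space M for M :: "env measure" +
  assumes sets_M: "sets M = sets env_space"
    and cookies: "AE \<omega> in M. \<forall>z k. \<omega> z k \<in> {1/2..1}"
    and indep: "indep_vars (\<lambda>_. site_space) (\<lambda>x \<omega>. \<omega> x) {0..}"
    and same_law: "\<forall>x\<ge>0. distr M site_space (\<lambda>\<omega>. \<omega> x) = distr M site_space (\<lambda>\<omega>. \<omega> 0)"
    and two_cookies: "AE \<omega> in M. \<forall>k\<ge>2. \<omega> 0 k = 1/2"
begin

lemma AE_right_drift: "AE \<omega> in M. right_drift \<omega>"
  using cookies by (simp add: right_drift_def)

lemma measurable_M_PiM: "measurable M N = measurable (Pi\<^sub>M UNIV (\<lambda>_::int. site_space)) N"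
  by (rule measurable_cong_sets) (simp_all add: sets_M env_space_def)

lemma measurable_site [measurable]: "(\<lambda>\<omega>. \<omega> x) \<in> measurable M site_space"
  unfolding measurable_M_PiM by (rule measurable_component_singleton) simp

lemma measurable_cookie_M [measurable]: "(\<lambda>\<omega>. \<omega> z k) \<in> borel_measurable M"
  unfolding measurable_M_PiM by (rule measurable_cookie)

lemma measurable_hit_M [measurable]: "(\<lambda>\<omega>. hit \<omega> a b) \<in> borel_measurable M"
  unfolding measurable_M_PiM by (rule measurable_hit)

lemma integrable_hit: "integrable M (\<lambda>\<omega>. hit \<omega> a b)"
  by (rule integrable_const_bound[of _ 1])
     (use AE_right_drift in \<open>auto simp: abs_le_iff dest: hit_bounds intro: order_trans[of _ 0] elim!: eventually_mono\<close>)

lemma site_law: "0 \<le> x \<Longrightarrow> distr M site_space (\<lambda>\<omega>. \<omega> x) = distr M site_space (\<lambda>\<omega>. \<omega> 0)"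
  using same_law by blast

lemma integral_site_shift:
  assumes "\<phi> \<in> borel_measurable site_space" "0 \<le> x"
  shows "(\<integral>\<omega>. \<phi> (\<omega> x) \<partial>M) = (\<integral>\<omega>. (\<phi> (\<omega> 0) :: real) \<partial>M)"
proof -
  have "(\<integral>\<omega>. \<phi> (\<omega> x) \<partial>M) = (\<integral>v. \<phi> v \<partial>distr M site_space (\<lambda>\<omega>. \<omega> x))"
    by (rule integral_distr[symmetric]) (use assms in auto)
  also have "\<dots> = (\<integral>v. \<phi> v \<partial>distr M site_space (\<lambda>\<omega>. \<omega> 0))" by (simp only: site_law[OF assms(2)])
  also have "\<dots> = (\<integral>\<omega>. \<phi> (\<omega> 0) \<partial>M)" by (rule integral_distr) (use assms in auto)
  finally show ?thesis .
qed

lemma integrable_site_shift: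
  assumes "\<phi> \<in> borel_measurable site_space" "0 \<le> x" "integrable M (\<lambda>\<omega>. \<phi> (\<omega> 0) :: real)"
  shows "integrable M (\<lambda>\<omega>. \<phi> (\<omega> x))"
proof -
  have "integrable (distr M site_space (\<lambda>\<omega>. \<omega> 0)) \<phi>"
    by (subst integrable_distr_eq) (use assms in auto)
  then have "integrable (distr M site_space (\<lambda>\<omega>. \<omega> x)) \<phi>" by (simp only: site_law[OF assms(2)])
  then show ?thesis by (subst (asm) integrable_distr_eq) (use assms in auto)
qed

text \<open>The assumption concerns site 0 only; equality of the site laws carries it to each
  nonnegative site, and countably many exceptional null sets are united.\<close>

lemma AE_two_cookies: "AE \<omega> in M. \<forall>x\<ge>0. \<forall>k\<ge>2. \<omega> x k = 1/2"
proof -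
  have "AE \<omega> in M. \<omega> x k = 1/2" if "0 \<le> x" "2 \<le> k" for x k
  proof -
    have "(\<lambda>v. v k) -` {1/2} \<inter> space site_space \<in> sets site_space"
      by (rule measurable_sets[OF measurable_site_coord]) simp
    then have meas: "{v \<in> space site_space. v k = 1/2} \<in> sets site_space"
      by (simp add: vimage_def Int_def conj_commute)
    have "AE \<omega> in M. \<omega> 0 k = 1/2"
      using two_cookies by (rule eventually_mono) (use that in simp)
    then have "AE v in distr M site_space (\<lambda>\<omega>. \<omega> 0). v k = 1/2"
      by (simp only: AE_distr_iff[OF measurable_site meas])
    then have "AE v in distr M site_space (\<lambda>\<omega>. \<omega> x). v k = 1/2" by (simp only: site_law[OF that(1)])
    then show ?thesis by (simp only: AE_distr_iff[OF measurable_site meas])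
  qed
  then have "AE \<omega> in M. 0 \<le> x \<and> 2 \<le> k \<longrightarrow> \<omega> x k = 1/2" for x k
    by (cases "0 \<le> x \<and> 2 \<le> k") auto
  then have "AE \<omega> in M. \<forall>x k. 0 \<le> x \<and> 2 \<le> k \<longrightarrow> \<omega> x k = 1/2"
    by (simp only: AE_all_countable) simp
  then show ?thesis by (rule eventually_mono) blast
qed

text \<open>Only the sites strictly between \<open>x\<close> and \<open>K\<close> are read. The
  joint law of such a block is a product of identical site laws, so it is invariant under shifts
  within the nonnegative half-line.\<close>

lemma integral_hit_shift:
  assumes "0 \<le> x" "x < K"
  shows "(\<integral>\<omega>. hit \<omega> x K \<partial>M) = (\<integral>\<omega>. hit \<omega> 0 (K - x) \<partial>M)"
proof -
  let ?J = "{0..<K - x}"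
  let ?P = "Pi\<^sub>M ?J (\<lambda>_. site_space)"
  have J: "?J \<noteq> {}" using assms by simp
  \<comment> \<open>Reindexing by \<open>i + x\<close> is obtained by grouping the independent
    family into the singletons \<open>{i + x}\<close>.\<close>
  have "indep_vars (\<lambda>i. site_space) (\<lambda>i \<omega>. restrict \<omega> {i + x} (i + x)) ?J"
    by (rule indep_vars_compose2[OF indep_vars_restrict[OF indep]])
       (use assms in \<open>auto simp: disjoint_family_on_def\<close>)
  then have "indep_vars (\<lambda>_. site_space) (\<lambda>i \<omega>. \<omega> (i + x)) ?J" by simp
  then have "distr M ?P (\<lambda>\<omega>. \<lambda>i\<in>?J. \<omega> (i + x)) = Pi\<^sub>M ?J (\<lambda>i. distr M site_space (\<lambda>\<omega>. \<omega> (i + x)))"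
    by (subst (asm) indep_vars_iff_distr_eq_PiM'[OF J]) auto
  also have "\<dots> = Pi\<^sub>M ?J (\<lambda>i. distr M site_space (\<lambda>\<omega>. \<omega> i))"
    by (rule PiM_cong[OF refl], rule trans[OF site_law site_law[symmetric]]) (use assms in auto)
  also have "\<dots> = distr M ?P (\<lambda>\<omega>. \<lambda>i\<in>?J. \<omega> i)"
    by (rule indep_vars_iff_distr_eq_PiM'[OF J, THEN iffD1, symmetric])
       (auto intro!: indep_vars_subset[OF indep])
  finally have eq: "distr M ?P (\<lambda>\<omega>. \<lambda>i\<in>?J. \<omega> (i + x)) = distr M ?P (\<lambda>\<omega>. \<lambda>i\<in>?J. \<omega> i)" .
  have "(\<integral>\<omega>. hit \<omega> x K \<partial>M) = (\<integral>\<omega>. hit (\<lambda>i\<in>?J. \<omega> (i + x)) 0 (K - x) \<partial>M)"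
    by (rule Bochner_Integration.integral_cong[OF refl], subst hit_shift[where x = x]) auto
  also have "\<dots> = (\<integral>\<eta>. hit \<eta> 0 (K - x) \<partial>distr M ?P (\<lambda>\<omega>. \<lambda>i\<in>?J. \<omega> (i + x)))"
    by (rule integral_distr[symmetric]) (intro measurable_restrict measurable_site measurable_hit)+
  also have "\<dots> = (\<integral>\<omega>. hit (\<lambda>i\<in>?J. \<omega> i) 0 (K - x) \<partial>M)"
    unfolding eq by (rule integral_distr) (intro measurable_restrict measurable_site measurable_hit)+
  also have "\<dots> = (\<integral>\<omega>. hit \<omega> 0 (K - x) \<partial>M)"
    by (rule Bochner_Integration.integral_cong[OF refl], subst hit_shift[where x = 0]) auto
  finally show ?thesis .
qed

text \<open>\<open>hit \<omega> 0 x\<close>, \<open>\<omega> x\<close> and \<open>hit \<omega> x K\<close> depend on disjoint blocks of sites.\<close>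
lemma expectation_blocks:
  assumes "0 \<le> x" "x < K" "\<phi> \<in> borel_measurable site_space" "integrable M (\<lambda>\<omega>. \<phi> (\<omega> 0) :: real)"
  shows "(\<integral>\<omega>. \<phi> (\<omega> x) * hit \<omega> 0 x * hit \<omega> x K \<partial>M)
       = (\<integral>\<omega>. \<phi> (\<omega> 0) \<partial>M) * (\<integral>\<omega>. hit \<omega> 0 x \<partial>M) * (\<integral>\<omega>. hit \<omega> 0 (K - x) \<partial>M)"
    and "integrable M (\<lambda>\<omega>. \<phi> (\<omega> x) * hit \<omega> 0 x * hit \<omega> x K)"
proof -
  let ?L = "{0, 1, 2} :: nat set"
  define B :: "nat \<Rightarrow> int set" where "B i = (if i = 0 then {x} else if i = 1 then {0<..<x} else {x<..<K})" for i
  define Y :: "nat \<Rightarrow> env \<Rightarrow> real"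
    where "Y i \<eta> = (if i = 0 then \<phi> (\<eta> x) else if i = 1 then hit \<eta> 0 x else hit \<eta> x K)" for i \<eta>
  have ind: "indep_vars (\<lambda>j. Pi\<^sub>M (B j) (\<lambda>_. site_space)) (\<lambda>j \<omega>. restrict \<omega> (B j)) ?L"
  proof (rule indep_vars_restrict[OF indep])
    show "\<And>j. j \<in> ?L \<Longrightarrow> B j \<subseteq> {0..}" "disjoint_family_on B ?L"
      using assms by (auto simp: B_def disjoint_family_on_def)
  qed
  have Y_meas: "Y i \<in> borel_measurable (Pi\<^sub>M (B i) (\<lambda>_. site_space))" for i
  proof -
    have "(\<lambda>\<eta>. \<phi> (\<eta> x)) \<in> borel_measurable (Pi\<^sub>M {x} (\<lambda>_. site_space))"
      by (rule measurable_compose[OF _ assms(3)], rule measurable_component_singleton) simp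
    then show ?thesis by (cases "i = 0"; cases "i = 1") (simp_all add: Y_def[abs_def] B_def measurable_hit)
  qed
  \<comment> \<open>Restricting to the open interval only alters sites that the hitting probability
    does not read.\<close>
  have hits: "hit (restrict \<omega> {0<..<x}) 0 x = hit \<omega> 0 x" "hit (restrict \<omega> {x<..<K}) x K = hit \<omega> x K" for \<omega>
    by (subst hit_shift[where x = 0]; simp)+
  have Y_eq: "Y i (restrict \<omega> (B i)) = (if i = 0 then \<phi> (\<omega> x) else if i = 1 then hit \<omega> 0 x else hit \<omega> x K)" for i \<omega>
    by (auto simp: Y_def B_def hits)
  have Y_ind: "indep_vars (\<lambda>_. borel) (\<lambda>i \<omega>. Y i (restrict \<omega> (B i))) ?L"
    by (rule indep_vars_compose2[OF ind]) (rule Y_meas)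
  have Y_int: "integrable M (\<lambda>\<omega>. Y i (restrict \<omega> (B i)))" for i
    using integrable_site_shift[OF assms(3,1,4)] by (cases "i = 0"; cases "i = 1") (simp_all add: Y_eq integrable_hit)
  show "(\<integral>\<omega>. \<phi> (\<omega> x) * hit \<omega> 0 x * hit \<omega> x K \<partial>M)
      = (\<integral>\<omega>. \<phi> (\<omega> 0) \<partial>M) * (\<integral>\<omega>. hit \<omega> 0 x \<partial>M) * (\<integral>\<omega>. hit \<omega> 0 (K - x) \<partial>M)"
    using indep_vars_lebesgue_integral[OF _ Y_ind Y_int]
    by (simp add: Y_eq integral_site_shift[OF assms(3,1)] integral_hit_shift[OF assms(1,2)] mult.assoc)
  show "integrable M (\<lambda>\<omega>. \<phi> (\<omega> x) * hit \<omega> 0 x * hit \<omega> x K)"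
    using indep_vars_integrable[OF _ Y_ind Y_int] by (simp add: Y_eq mult.assoc)
qed

end

section \<open>The quenched escape probability\<close>

abbreviation unif01 :: "real measure" where
  "unif01 \<equiv> uniform_measure lborel {0..1}"

interpretation unif01: prob_space unif01
  by (rule prob_space_uniform_measure) auto

interpretation unif_seq: sequence_space unif01
  by unfold_locales

interpretation unif_seq_prob: prob_space unif_seq
  unfolding unif_seq_def by (rule unif_seq.P.prob_space_axioms)

lemma space_unif_seq [simp]: "space unif_seq = UNIV"
  by (auto simp: unif_seq_def space_PiM)

lemma measure_unif01_less: "measure unif01 {v. v < w} = max 0 (min 1 w)"
proof -
  have "{0..1} \<inter> {v. v < w} = (if w \<le> 1 then {0..<w} else {0..1})" by auto
  then have "measure lborel ({0..1} \<inter> {v. v < w}) = max 0 (min 1 w)"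
    by (cases "0 \<le> w") auto
  moreover have "measure unif01 {v. v < w} = measure lborel ({0..1} \<inter> {v. v < w}) / measure lborel {0..1::real}"
    by (rule measure_uniform_measure) auto
  ultimately show ?thesis by simp
qed

lemma measure_unif01_ge: "measure unif01 {v. \<not> v < w} = 1 - max 0 (min 1 w)"
proof -
  have eq: "{v. \<not> v < w} = space unif01 - {v. v < w}" by auto
  have "{v. v < w} \<in> sets unif01" by simp
  from unif01.prob_compl[OF this] show ?thesis
    unfolding eq by (simp only: measure_unif01_less)
qed

lemma measurable_shift_unif_seq: "(\<lambda>u k. u (Suc k)) \<in> measurable unif_seq unif_seq"
  unfolding unif_seq_def by (rule measurable_PiM_single') (auto simp: space_PiM)

text \<open>The first uniform variable is independent of the shifted sequence, which again has law
  \<open>unif_seq\<close>. \<open>A\<close> and \<open>B\<close> are the events for the continuation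
  after a jump to the right or to the left.\<close>

lemma unif_seq_first_step:
  fixes w :: real
  assumes A: "A \<in> sets unif_seq" and B: "B \<in> sets unif_seq"
  defines "E \<equiv> {u. if u 0 < w then (\<lambda>k. u (Suc k)) \<in> A else (\<lambda>k. u (Suc k)) \<in> B}"
  shows "E \<in> sets unif_seq"
    and "measure unif_seq E = max 0 (min 1 w) * measure unif_seq A + (1 - max 0 (min 1 w)) * measure unif_seq B"
proof -
  have proj: "(\<lambda>u. u 0) \<in> measurable unif_seq unif01"
    unfolding unif_seq_def by (rule measurable_component_singleton) simp
  have "E = ((\<lambda>u. u 0) -` {v. v < w} \<inter> (\<lambda>u k. u (Suc k)) -` A)
      \<union> ((\<lambda>u. u 0) -` {v. \<not> v < w} \<inter> (\<lambda>u k. u (Suc k)) -` B)"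
    by (auto simp: E_def)
  moreover have "(\<lambda>u. u 0) -` {v. v < w} \<in> sets unif_seq" "(\<lambda>u. u 0) -` {v. \<not> v < w} \<in> sets unif_seq"
    using measurable_sets[OF proj, of "{v. v < w}"] measurable_sets[OF proj, of "{v. \<not> v < w}"] by auto
  moreover have "(\<lambda>u k. u (Suc k)) -` A \<in> sets unif_seq" "(\<lambda>u k. u (Suc k)) -` B \<in> sets unif_seq"
    using measurable_sets[OF measurable_shift_unif_seq A] measurable_sets[OF measurable_shift_unif_seq B] by auto
  ultimately show E: "E \<in> sets unif_seq" by auto
  let ?P = "unif01 \<Otimes>\<^sub>M unif_seq"
  let ?cn = "\<lambda>(s, u). case_nat s u :: nat \<Rightarrow> real"
  have cn: "?cn \<in> measurable ?P unif_seq"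
    unfolding unif_seq_def by measurable
  have U: "{v. v < w} \<in> sets unif01" "{v. \<not> v < w} \<in> sets unif01" by auto
  have times: "measure ?P (X \<times> Y) = measure unif01 X * measure unif_seq Y"
    if "X \<in> sets unif01" "Y \<in> sets unif_seq" for X Y
    unfolding measure_def unif_seq_prob.emeasure_pair_measure_Times[OF that] by (rule enn2real_mult)
  have fin: "emeasure ?P X \<noteq> \<infinity>" for X
  proof -
    interpret P: pair_prob_space unif01 unif_seq ..
    show ?thesis using P.emeasure_finite by simp
  qed
  \<comment> \<open>Prepending an independent uniform variable to the sequence reproduces its
    law.\<close>
  have "measure unif_seq E = measure (distr ?P unif_seq ?cn) E"
    using unif_seq.PiM_iter by (simp add: unif_seq_def)
  also have "\<dots> = measure ?P (?cn -` E \<inter> space ?P)" by (rule measure_distr[OF cn E])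
  also have "?cn -` E \<inter> space ?P = ({v. v < w} \<times> A) \<union> ({v. \<not> v < w} \<times> B)"
    by (auto simp: E_def space_pair_measure)
  also have "measure ?P \<dots> = measure ?P ({v. v < w} \<times> A) + measure ?P ({v. \<not> v < w} \<times> B)"
    by (rule measure_Union) (use A B U fin in auto)
  also have "\<dots> = max 0 (min 1 w) * measure unif_seq A + (1 - max 0 (min 1 w)) * measure unif_seq B"
    by (simp only: times[OF U(1) A] times[OF U(2) B] measure_unif01_less measure_unif01_ge)
  finally show "measure unif_seq E = max 0 (min 1 w) * measure unif_seq A + (1 - max 0 (min 1 w)) * measure unif_seq B" .
qed

section \<open>The walk driven by uniform variables\<close>

primrec walk_from :: "env \<Rightarrow> int \<times> (int \<Rightarrow> nat) \<Rightarrow> (nat \<Rightarrow> real) \<Rightarrow> nat \<Rightarrow> int \<times> (int \<Rightarrow> nat)" where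
  "walk_from \<omega> s u 0 = s"
| "walk_from \<omega> s u (Suc n) =
     (let (y, c) = walk_from \<omega> s u n
      in (if u n < \<omega> y (c y) then y + 1 else y - 1, c(y := c y + 1)))"

lemma walk_eq_walk_from: "walk \<omega> x u n = fst (walk_from \<omega> (x, \<lambda>_. 0) u n)"
proof -
  have "walk_state \<omega> x u n = walk_from \<omega> (x, \<lambda>_. 0) u n" by (induction n) auto
  then show ?thesis by (simp add: walk_def)
qed

text \<open>The recursion appends the last step, whereas first-step analysis peels off the first.
  After that step the counts are no longer zero, hence the arbitrary initial state in
  \<open>walk_from\<close>.\<close>

lemma walk_from_first_step:
  "walk_from \<omega> (y, c) u (Suc n) =
     walk_from \<omega> (if u 0 < \<omega> y (c y) then y + 1 else y - 1, c(y := c y + 1)) (\<lambda>k. u (Suc k)) n"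
proof (induction n)
  case (Suc n)
  then show ?case by (subst walk_from.simps(2)) (simp only: walk_from.simps(2)[of _ _ "\<lambda>k. u (Suc k)"])
qed (simp add: fun_upd_def)

definition stays_positive :: "env \<Rightarrow> nat \<Rightarrow> int \<times> (int \<Rightarrow> nat) \<Rightarrow> (nat \<Rightarrow> real) set" where
  "stays_positive \<omega> n s = {u. \<forall>m\<le>n. 0 < fst (walk_from \<omega> s u m)}"

text \<open>Clipping makes the formula for \<open>quenched_prob\<close> valid for every environment, not just almost
  every one, which is how its measurability in the environment is obtained.\<close>
definition clip :: "env \<Rightarrow> env" where
  "clip \<omega> z k = max 0 (min 1 (\<omega> z k))"

lemma clip_right_drift: "right_drift \<omega> \<Longrightarrow> clip \<omega> = \<omega>"
  by (intro ext) (simp add: clip_def right_driftD)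

text \<open>Induction on the horizon, matching the first step of the random sequence with the step
  operator. Measurability is carried along because computing the probability uses it for both
  continuation events.\<close>

lemma stays_positive_measure:
  "stays_positive \<omega> n s \<in> sets unif_seq \<and> measure unif_seq (stays_positive \<omega> n s) = survive (clip \<omega>) n s"
proof (induction n arbitrary: s)
  case 0
  have "stays_positive \<omega> 0 s = (if 0 < fst s then UNIV else {})" by (auto simp: stays_positive_def)
  then show ?case using unif_seq_prob.prob_space sets.top[of unif_seq] by (auto simp: of_bool_def)
next
  case (Suc n)
  obtain y c where s: "s = (y, c)" by (cases s)
  show ?case
  proof (cases "0 < y")
    case True
    let ?c = "c(y := c y + 1)"
    have split_Suc: "(\<forall>m\<le>Suc n. Q m) \<longleftrightarrow> Q 0 \<and> (\<forall>m\<le>n. Q (Suc m))" for Q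
      by (metis Suc_le_mono not0_implies_Suc zero_le)
    have eq: "stays_positive \<omega> (Suc n) s =
        {u. if u 0 < \<omega> y (c y) then (\<lambda>k. u (Suc k)) \<in> stays_positive \<omega> n (y + 1, ?c)
            else (\<lambda>k. u (Suc k)) \<in> stays_positive \<omega> n (y - 1, ?c)}"
      unfolding stays_positive_def s split_Suc walk_from_first_step using True by auto
    have D: "y \<in> {0<..}" using True by simp
    note IH = Suc.IH[of "(y + 1, ?c)"] Suc.IH[of "(y - 1, ?c)"]
    note step = unif_seq_first_step[OF IH(1)[THEN conjunct1] IH(2)[THEN conjunct1], of "\<omega> y (c y)"]
    have "clip \<omega> y (c y) = max 0 (min 1 (\<omega> y (c y)))" by (simp add: clip_def)
    then show ?thesis
      unfolding eq unfolding s stop_iter_inside[OF D]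
      using step IH by simp
  next
    case False
    then have "stays_positive \<omega> (Suc n) s = {}" by (auto simp: stays_positive_def s)
    moreover have "survive (clip \<omega>) (Suc n) s = 0"
      using False by (subst stop_iter_outside) (auto simp: s)
    ultimately show ?thesis by simp
  qed
qed

text \<open>The first step must lead to 1, with probability \<open>clip \<omega> 0 0\<close>.
  Staying positive from there on is the decreasing limit of the events with finite horizon.\<close>

lemma quenched_positive_eq:
  "quenched_prob \<omega> 0 (\<lambda>X. \<forall>n>0. X n > 0) = clip \<omega> 0 0 * lim (\<lambda>n. survive (clip \<omega>) n (1, \<lambda>_. 0))"
proof -
  let ?s = "(1, (\<lambda>_. 0)(0 := 1)) :: int \<times> (int \<Rightarrow> nat)"
  let ?A = "\<Inter>n. stays_positive \<omega> n ?s"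
  have sets: "stays_positive \<omega> n ?s \<in> sets unif_seq" for n using stays_positive_measure by blast
  have "(\<lambda>n. measure unif_seq (stays_positive \<omega> n ?s)) \<longlonglongrightarrow> measure unif_seq ?A"
    by (rule unif_seq_prob.finite_Lim_measure_decseq)
       (use sets in \<open>auto simp: stays_positive_def intro!: decseq_SucI\<close>)
  \<comment> \<open>The visit already paid to site 0 may be forgotten, since the walk is frozen
    there.\<close>
  moreover have "survive (clip \<omega>) n ?s = survive (clip \<omega>) n (1, \<lambda>_. 0)" for n
    using stop_iter_shift[where x = 0 and D = "{0<..}" and D' = "{0<..}" and \<omega> = "clip \<omega>" and \<omega>' = "clip \<omega>"
        and F = "\<lambda>z. of_bool (1 \<le> z)" and F' = "\<lambda>z. of_bool (1 \<le> z)" and y = 1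
        and c = "(\<lambda>_. 0)(0 := 1)" and c' = "\<lambda>_. 0" and n = n] by simp
  ultimately have A: "measure unif_seq ?A = lim (\<lambda>n. survive (clip \<omega>) n (1, \<lambda>_. 0))"
    using stays_positive_measure by (intro limI[symmetric]) simp
  have "{u. \<forall>n>0. walk \<omega> 0 u n > 0} =
      {u. if u 0 < \<omega> 0 0 then (\<lambda>k. u (Suc k)) \<in> ?A else (\<lambda>k. u (Suc k)) \<in> {}}" (is "?L = ?R")
  proof (rule set_eqI)
    fix u
    have "u \<in> ?L \<longleftrightarrow> (\<forall>n. 0 < fst (walk_from \<omega> (0, \<lambda>_. 0) u (Suc n)))"
      by (simp only: mem_Collect_eq walk_eq_walk_from) (metis gr0_conv_Suc)
    also have "\<dots> \<longleftrightarrow> (\<forall>n. 0 < fst (walk_from \<omega> (if u 0 < \<omega> 0 0 then 1 else - 1, (\<lambda>_. 0)(0 := 1)) (\<lambda>k. u (Suc k)) n))"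
      by (simp only: walk_from_first_step) simp
    also have "\<dots> \<longleftrightarrow> u \<in> ?R"
      by (auto simp: stays_positive_def intro: exI[of _ 0])
    finally show "u \<in> ?L \<longleftrightarrow> u \<in> ?R" .
  qed
  then have "quenched_prob \<omega> 0 (\<lambda>X. \<forall>n>0. X n > 0) = measure unif_seq ?R"
    by (simp only: quenched_prob_def space_unif_seq) simp
  also have "\<dots> = clip \<omega> 0 0 * measure unif_seq ?A"
    by (subst unif_seq_first_step(2)) (use sets in \<open>auto simp: clip_def\<close>)
  finally show ?thesis unfolding A .
qed

lemma hit_tendsto_quenched:
  assumes "right_drift \<omega>"
  shows "(\<lambda>K. \<omega> 0 0 * hit \<omega> 0 (int K)) \<longlonglongrightarrow> quenched_prob \<omega> 0 (\<lambda>X. \<forall>n>0. X n > 0)"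
proof -
  obtain S where S: "(\<lambda>n. survive \<omega> n (1, \<lambda>_. 0)) \<longlonglongrightarrow> S" "(\<lambda>K. hit \<omega> 0 (int K)) \<longlonglongrightarrow> S"
    using hit_and_survive_same_limit[OF assms] .
  have "quenched_prob \<omega> 0 (\<lambda>X. \<forall>n>0. X n > 0) = \<omega> 0 0 * S"
    by (simp add: quenched_positive_eq clip_right_drift[OF assms] limI[OF S(1)])
  then show ?thesis using tendsto_mult_left[OF S(2)] by simp
qed

text \<open>The interval is empty, so the walk starts at its exit. Taking \<open>K = x + 1\<close>
  in \<open>expectation_blocks\<close> removes the factor \<open>hit \<omega> x K\<close>.\<close>

lemma hit_adjacent: "hit \<omega> a (a + 1) = 1"
  by (simp add: hit_def exit_mean_outside)

lemma hit_0_0: "hit \<omega> 0 0 = 1"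
  by (simp add: hit_def exit_mean_outside)

lemma delta0_eq:
  assumes "\<forall>k\<ge>2. \<omega> 0 k = 1/2"
  shows "delta0 \<omega> = (2 * \<omega> 0 0 - 1) + (2 * \<omega> 0 1 - 1)"
proof -
  have "delta0 \<omega> = (\<Sum>k\<in>{0, 1}. 2 * \<omega> 0 k - 1)"
    unfolding delta0_def
  proof (rule suminf_finite)
    fix k :: nat assume "k \<notin> {0, 1}"
    then have "2 \<le> k" by (cases k; cases "k - 1") auto
    then have "\<omega> 0 k = 1/2" using assms by blast
    then show "2 * \<omega> 0 k - 1 = 0" by simp
  qed simp
  then show ?thesis by simp
qed

section \<open>The annealed escape probability\<close>

context iid_cookies
begin

lemma integrable_cookie: "integrable M (\<lambda>\<omega>. \<omega> z k)"
  by (rule integrable_const_bound[of _ 1])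
     (use AE_right_drift in \<open>auto elim!: eventually_mono simp: abs_le_iff right_driftD intro: order_trans[of _ 0]\<close>)

lemma integrable_cookie_mult: "integrable M (\<lambda>\<omega>. (2 * \<omega> z 1 - 1) * \<omega> z 0)"
proof (rule integrable_const_bound[of _ 1])
  show "AE \<omega> in M. norm ((2 * \<omega> z 1 - 1) * \<omega> z 0) \<le> 1"
    using AE_right_drift
  proof (rule eventually_mono)
    fix \<omega> assume "right_drift \<omega>"
    from right_driftD[OF this, of z 0] right_driftD[OF this, of z 1]
    show "norm ((2 * \<omega> z 1 - 1) * \<omega> z 0) \<le> 1"
      by (auto simp: abs_mult intro!: mult_le_one)
  qed
qed simp

text \<open>Dominated convergence of the quenched probabilities. The mean factorises because the
  first jump uses site 0, while \<open>hit \<omega> 0 K\<close> reads only sites strictly between 0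
  and \<open>K\<close>.\<close>

lemma annealed_positive_limit:
  "(\<lambda>K. (\<integral>\<omega>. \<omega> 0 0 \<partial>M) * (\<integral>\<omega>. hit \<omega> 0 (int K) \<partial>M)) \<longlonglongrightarrow> annealed_prob M 0 (\<lambda>X. \<forall>n>0. X n > 0)"
proof -
  let ?Q = "\<lambda>\<omega>. quenched_prob \<omega> 0 (\<lambda>X. \<forall>n>0. X n > 0)"
  have coord: "(\<lambda>v. v 0) \<in> borel_measurable site_space" by (rule measurable_site_coord)
  have meas_site: "(\<lambda>v k. max 0 (min 1 (v k))) \<in> measurable site_space site_space"
    unfolding site_space_def by (rule measurable_PiM_single') (auto simp: space_PiM)
  have clip_meas: "clip \<in> measurable M (Pi\<^sub>M UNIV (\<lambda>_. site_space))"
  proof -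
    have "(\<lambda>\<omega> z. (\<lambda>k. max 0 (min 1 (\<omega> z k)))) \<in> measurable M (Pi\<^sub>M UNIV (\<lambda>_. site_space))"
    proof (rule measurable_PiM_single')
      show "(\<lambda>\<omega> k. max 0 (min 1 (\<omega> z k))) \<in> measurable M site_space" for z
        by (rule measurable_compose[OF measurable_site meas_site])
    qed (auto simp: site_space_def space_PiM)
    moreover have "clip = (\<lambda>\<omega> z. (\<lambda>k. max 0 (min 1 (\<omega> z k))))" by (intro ext) (simp add: clip_def)
    ultimately show ?thesis by simp
  qed
  have "(\<lambda>\<omega>. lim (\<lambda>n. survive (clip \<omega>) n (1, \<lambda>_. 0))) \<in> borel_measurable M"
    by (rule borel_measurable_lim_metric) (rule measurable_compose[OF clip_meas measurable_stop_iter])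
  moreover have "(\<lambda>\<omega>. clip \<omega> 0 0) \<in> borel_measurable M"
    by (rule measurable_compose[OF clip_meas measurable_cookie])
  ultimately have Q_meas: "?Q \<in> borel_measurable M"
    by (simp add: quenched_positive_eq)
  have "(\<lambda>K. \<integral>\<omega>. \<omega> 0 0 * hit \<omega> 0 (int K) \<partial>M) \<longlonglongrightarrow> (\<integral>\<omega>. ?Q \<omega> \<partial>M)"
  proof (rule integral_dominated_convergence[where w = "\<lambda>_. 1"])
    show "AE \<omega> in M. (\<lambda>K. \<omega> 0 0 * hit \<omega> 0 (int K)) \<longlonglongrightarrow> ?Q \<omega>"
      using AE_right_drift by (rule eventually_mono) (rule hit_tendsto_quenched)
    show "AE \<omega> in M. norm (\<omega> 0 0 * hit \<omega> 0 (int K)) \<le> 1" for K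
      using AE_right_drift
      by (rule eventually_mono) (auto simp: abs_mult right_driftD hit_bounds intro!: mult_le_one)
  qed (use Q_meas in auto)
  moreover have "(\<integral>\<omega>. \<omega> 0 0 * hit \<omega> 0 (int K) \<partial>M) = (\<integral>\<omega>. \<omega> 0 0 \<partial>M) * (\<integral>\<omega>. hit \<omega> 0 (int K) \<partial>M)" for K
  proof (cases "K = 0")
    case False
    then show ?thesis
      using expectation_blocks(1)[of 0 "int K" "\<lambda>v. v 0"] coord integrable_cookie[of 0 0] by (simp add: hit_0_0 prob_space)
  qed (simp add: hit_0_0 prob_space)
  ultimately show ?thesis by (simp add: annealed_prob_def)
qed

text \<open>Averaging the quenched recursion over independent sites yields the hypotheses of
  \<open>renewal_limit\<close>, with the mean site drift as \<open>d\<close> and the mean of the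
  product in the denominator as \<open>a\<close>.\<close>

lemma mean_hit_limit:
  assumes lim: "(\<lambda>K. \<integral>\<omega>. hit \<omega> 0 (int K) \<partial>M) \<longlonglongrightarrow> l"
    and nontrivial: "measure M {\<omega> \<in> space M. \<omega> 0 1 = 1/2} < 1"
  shows "l = max ((\<integral>\<omega>. delta0 \<omega> \<partial>M) - 1) 0 / (\<integral>\<omega>. (2 * \<omega> 0 1 - 1) * \<omega> 0 0 \<partial>M)"
proof -
  define p where "p K = (\<integral>\<omega>. hit \<omega> 0 (int K) \<partial>M)" for K :: nat
  define \<phi> :: "(nat \<Rightarrow> real) \<Rightarrow> real" where "\<phi> v = (2 * v 0 - 1) + (2 * v 1 - 1)" for v
  define \<psi> :: "(nat \<Rightarrow> real) \<Rightarrow> real" where "\<psi> v = (2 * v 1 - 1) * v 0" for v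
  define d where "d = (\<integral>\<omega>. \<phi> (\<omega> 0) \<partial>M)"
  define a where "a = (\<integral>\<omega>. \<psi> (\<omega> 0) \<partial>M)"
  have \<phi>: "\<phi> \<in> borel_measurable site_space" "integrable M (\<lambda>\<omega>. \<phi> (\<omega> 0))"
    and \<psi>: "\<psi> \<in> borel_measurable site_space" "integrable M (\<lambda>\<omega>. \<psi> (\<omega> 0))"
    unfolding \<phi>_def[abs_def] \<psi>_def[abs_def]
    using measurable_site_coord integrable_cookie_mult[of 0] integrable_cookie by (auto intro!: borel_measurable_add borel_measurable_times borel_measurable_diff)
  have delta: "(\<integral>\<omega>. delta0 \<omega> \<partial>M) = d"
    unfolding d_def
  proof (rule integral_cong_AE)
    show "AE \<omega> in M. delta0 \<omega> = \<phi> (\<omega> 0)"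
      using two_cookies by (rule eventually_mono) (simp only: delta0_eq \<phi>_def)
    show "delta0 \<in> borel_measurable M" unfolding delta0_def[abs_def] by measurable
    show "(\<lambda>\<omega>. \<phi> (\<omega> 0)) \<in> borel_measurable M" using \<phi>(2) by auto
  qed
  have a_pos: "0 < a"
  proof -
    have nonneg: "AE \<omega> in M. 0 \<le> \<psi> (\<omega> 0)"
      using AE_right_drift
    proof (rule eventually_mono)
      fix \<omega> assume "right_drift \<omega>"
      from right_driftD(1)[OF this, of 0 1] right_driftD(3)[OF this, of 0 0]
      show "0 \<le> \<psi> (\<omega> 0)" by (simp add: \<psi>_def)
    qed
    have "a \<noteq> 0"
    proof
      assume "a = 0"
      then have "AE \<omega> in M. \<psi> (\<omega> 0) = 0"
        unfolding a_def using integral_nonneg_eq_0_iff_AE[OF \<psi>(2) nonneg] by simp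
      \<comment> \<open>The first cookie is at least 1/2, so the vanishing product forces the second
        one to be fair.\<close>
      with AE_right_drift have "AE \<omega> in M. \<omega> 0 1 = 1/2"
        by eventually_elim (auto simp: \<psi>_def dest: right_driftD(1)[of _ 0 0])
      then have "measure M {\<omega> \<in> space M. \<omega> 0 1 = 1/2} = 1"
        by (subst prob_Collect_eq_1) auto
      then show False using nontrivial by simp
    qed
    moreover have "0 \<le> a" unfolding a_def by (rule integral_nonneg_AE[OF nonneg])
    ultimately show ?thesis by simp
  qed
  have p_bounds: "0 \<le> p K" "p K \<le> 1" for K
  proof -
    show "0 \<le> p K" unfolding p_def
      by (rule integral_nonneg_AE) (use AE_right_drift in \<open>auto elim!: eventually_mono simp: hit_bounds\<close>)
    have "p K \<le> (\<integral>\<omega>. 1 \<partial>M)" unfolding p_def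
      by (rule integral_mono_AE) (use AE_right_drift integrable_hit in \<open>auto elim!: eventually_mono simp: hit_bounds\<close>)
    then show "p K \<le> 1" by (simp add: prob_space)
  qed
  have p_anti: "p n \<le> p m" if "0 < m" "m \<le> n" for m n
    unfolding p_def
    by (rule integral_mono_AE)
       (use AE_right_drift integrable_hit that in \<open>auto elim!: eventually_mono simp: hit_antimono\<close>)
  have p_ge: "1 / real n \<le> p n" if "0 < n" for n
  proof -
    have "(\<integral>\<omega>. 1 / real n \<partial>M) \<le> p n"
      unfolding p_def
    proof (rule integral_mono_AE)
      show "AE \<omega> in M. 1 / real n \<le> hit \<omega> 0 (int n)"
        using AE_right_drift by (rule eventually_mono) (use hit_ge[of _ "int n"] that in simp)
    qed (use integrable_hit in auto)
    then show ?thesis by (simp add: prob_space)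
  qed
  \<comment> \<open>The quenched summand grouped into products over disjoint blocks of sites, so
    that its mean factorises.\<close>
  define T where "T K x \<omega> = \<phi> (\<omega> x) * hit \<omega> 0 x - \<psi> (\<omega> x) * hit \<omega> 0 x * hit \<omega> x K" for K x :: int and \<omega>
  have T_eq: "(2 * \<omega> x 0 - 1) * hit \<omega> 0 x + (2 * \<omega> x 1 - 1) * hit \<omega> 0 x
      - (2 * \<omega> x 1 - 1) * \<omega> x 0 * hit \<omega> 0 x * hit \<omega> x K = T K x \<omega>" for \<omega> x K
    by (simp add: T_def \<phi>_def \<psi>_def algebra_simps)
  have \<phi>_block: "integrable M (\<lambda>\<omega>. \<phi> (\<omega> x) * hit \<omega> 0 x)"
      "(\<integral>\<omega>. \<phi> (\<omega> x) * hit \<omega> 0 x \<partial>M) = d * p (nat x)" if "0 \<le> x" for x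
    using expectation_blocks[OF that _ \<phi>, of "x + 1"] that by (simp_all add: hit_adjacent hit_adjacent[of _ 0, simplified] prob_space d_def p_def)
  have \<psi>_block: "integrable M (\<lambda>\<omega>. \<psi> (\<omega> x) * hit \<omega> 0 x * hit \<omega> x K)"
      "(\<integral>\<omega>. \<psi> (\<omega> x) * hit \<omega> 0 x * hit \<omega> x K \<partial>M) = a * p (nat x) * p (nat (K - x))" if "0 \<le> x" "x < K" for x K
    using expectation_blocks[OF that \<psi>] that by (simp_all add: a_def p_def)
  have T_int: "integrable M (T K x)" and T_mean: "(\<integral>\<omega>. T K x \<omega> \<partial>M) = p (nat x) * (d - a * p (nat (K - x)))"
    if "0 \<le> x" "x < K" for x K
    unfolding T_def using \<phi>_block[OF that(1)] \<psi>_block[OF that] by (simp_all add: algebra_simps)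
  have reidx: "(\<Sum>x\<in>{0<..<int K}. f (nat x)) = (\<Sum>x\<in>{0<..<K}. (f x :: real))" for f K
    by (rule sum.reindex_bij_witness[of _ int nat]) auto
  have good: "AE \<omega> in M. right_drift \<omega> \<and> (\<forall>x\<ge>0. \<forall>k\<ge>2. \<omega> x k = 1/2)"
    using AE_right_drift AE_two_cookies by eventually_elim simp
  have lo: "1 + (\<Sum>x\<in>{0<..<K}. p x * (d - a * p (K - x)) - p x / real x) \<le> real K * p K" if "0 < K" for K
  proof -
    have lo_int: "integrable M (\<lambda>\<omega>. T (int K) x \<omega> - hit \<omega> 0 x / of_int x)" if "x \<in> {0<..<int K}" for x
      using T_int[of x "int K"] integrable_hit[of 0 x] that by simp
    have "(\<integral>\<omega>. 1 + (\<Sum>x\<in>{0<..<int K}. T (int K) x \<omega> - hit \<omega> 0 x / of_int x) \<partial>M) \<le> (\<integral>\<omega>. real K * hit \<omega> 0 (int K) \<partial>M)"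
    proof (rule integral_mono_AE)
      show "AE \<omega> in M. 1 + (\<Sum>x\<in>{0<..<int K}. T (int K) x \<omega> - hit \<omega> 0 x / of_int x) \<le> real K * hit \<omega> 0 (int K)"
        using good
      proof (rule eventually_mono)
        fix \<omega> assume "right_drift \<omega> \<and> (\<forall>x\<ge>0. \<forall>k\<ge>2. \<omega> x k = 1/2)"
        then show "1 + (\<Sum>x\<in>{0<..<int K}. T (int K) x \<omega> - hit \<omega> 0 x / of_int x) \<le> real K * hit \<omega> 0 (int K)"
          using hit_recursion(1)[of \<omega> "int K", unfolded One_nat_def[symmetric] T_eq] that by auto
      qed
    qed (auto intro!: Bochner_Integration.integrable_add Bochner_Integration.integrable_sum lo_int integrable_hit)
    also have "(\<integral>\<omega>. 1 + (\<Sum>x\<in>{0<..<int K}. T (int K) x \<omega> - hit \<omega> 0 x / of_int x) \<partial>M)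
        = 1 + (\<Sum>x\<in>{0<..<int K}. (\<integral>\<omega>. T (int K) x \<omega> - hit \<omega> 0 x / of_int x \<partial>M))"
      by (subst Bochner_Integration.integral_add)
         (auto simp: prob_space intro!: Bochner_Integration.integral_sum Bochner_Integration.integrable_sum lo_int)
    also have "(\<Sum>x\<in>{0<..<int K}. (\<integral>\<omega>. T (int K) x \<omega> - hit \<omega> 0 x / of_int x \<partial>M))
        = (\<Sum>x\<in>{0<..<int K}. p (nat x) * (d - a * p (K - nat x)) - p (nat x) / real (nat x))"
    proof (rule sum.cong[OF refl])
      fix x assume x: "x \<in> {0<..<int K}"
      then have "nat (int K - x) = K - nat x" by auto
      then show "(\<integral>\<omega>. T (int K) x \<omega> - hit \<omega> 0 x / of_int x \<partial>M)
          = p (nat x) * (d - a * p (K - nat x)) - p (nat x) / real (nat x)"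
        using x T_mean[of x "int K"] T_int[of x "int K"] integrable_hit[of 0 x]
        by (subst Bochner_Integration.integral_diff) (auto simp: p_def)
    qed
    also have "\<dots> = (\<Sum>x\<in>{0<..<K}. p x * (d - a * p (K - x)) - p x / real x)" by (rule reidx)
    finally show ?thesis by (simp add: p_def)
  qed
  have hi: "real K * p K \<le> 1 + (\<Sum>x\<in>{0<..<K}. p x * (d - a * p (K - x)))" if "0 < K" for K
  proof -
    have "(\<integral>\<omega>. real K * hit \<omega> 0 (int K) \<partial>M) \<le> (\<integral>\<omega>. 1 + (\<Sum>x\<in>{0<..<int K}. T (int K) x \<omega>) \<partial>M)"
    proof (rule integral_mono_AE)
      show "AE \<omega> in M. real K * hit \<omega> 0 (int K) \<le> 1 + (\<Sum>x\<in>{0<..<int K}. T (int K) x \<omega>)"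
        using good
      proof (rule eventually_mono)
        fix \<omega> assume "right_drift \<omega> \<and> (\<forall>x\<ge>0. \<forall>k\<ge>2. \<omega> x k = 1/2)"
        then show "real K * hit \<omega> 0 (int K) \<le> 1 + (\<Sum>x\<in>{0<..<int K}. T (int K) x \<omega>)"
          using hit_recursion(2)[of \<omega> "int K", unfolded One_nat_def[symmetric] T_eq] that by auto
      qed
    qed (auto intro!: Bochner_Integration.integrable_add Bochner_Integration.integrable_sum T_int integrable_hit)
    also have "\<dots> = 1 + (\<Sum>x\<in>{0<..<int K}. (\<integral>\<omega>. T (int K) x \<omega> \<partial>M))"
      by (subst Bochner_Integration.integral_add)
         (auto simp: prob_space intro!: Bochner_Integration.integral_sum Bochner_Integration.integrable_sum T_int)
    also have "(\<Sum>x\<in>{0<..<int K}. (\<integral>\<omega>. T (int K) x \<omega> \<partial>M)) = (\<Sum>x\<in>{0<..<int K}. p (nat x) * (d - a * p (K - nat x)))"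
    proof (rule sum.cong[OF refl])
      fix x assume x: "x \<in> {0<..<int K}"
      then have "nat (int K - x) = K - nat x" by auto
      then show "(\<integral>\<omega>. T (int K) x \<omega> \<partial>M) = p (nat x) * (d - a * p (K - nat x))"
        using x T_mean[of x "int K"] by auto
    qed
    also have "\<dots> = (\<Sum>x\<in>{0<..<K}. p x * (d - a * p (K - x)))" by (rule reidx)
    finally show ?thesis by (simp add: p_def)
  qed
  have "l = max (d - 1) 0 / a"
    by (rule renewal_limit[OF p_bounds p_anti p_ge a_pos lo hi lim[folded p_def]])
  then show ?thesis unfolding delta a_def \<psi>_def .
qed

lemma mean_hit_convergent: "convergent (\<lambda>K. \<integral>\<omega>. hit \<omega> 0 (int K) \<partial>M)"
proof -
  \<comment> \<open>Monotonicity is available for positive endpoints only, hence the shift by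
    \<open>Suc\<close>.\<close>
  let ?p = "\<lambda>K. \<integral>\<omega>. hit \<omega> 0 (int (Suc K)) \<partial>M"
  have "decseq ?p"
    by (rule decseq_SucI, rule integral_mono_AE)
       (use AE_right_drift integrable_hit in \<open>auto elim!: eventually_mono simp: hit_antimono\<close>)
  moreover have "0 \<le> ?p K" for K
    by (rule integral_nonneg_AE) (use AE_right_drift in \<open>auto elim!: eventually_mono simp: hit_bounds\<close>)
  ultimately obtain l where "?p \<longlonglongrightarrow> l" using decseq_convergent by metis
  from LIMSEQ_imp_Suc[OF this] show ?thesis by (auto simp: convergent_def)
qed

end

theorem mainTheorem18:
  fixes M :: "env measure"
  assumes "prob_space M"
    and "sets M = sets env_space"
    and "AE \<omega> in M. \<forall>z k. \<omega> z k \<in> {1/2..1}"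
    and "prob_space.indep_vars M (\<lambda>_. site_space) (\<lambda>x \<omega>. \<omega> x) {0..}"
    and "\<forall>x\<ge>0. distr M site_space (\<lambda>\<omega>. \<omega> x) = distr M site_space (\<lambda>\<omega>. \<omega> 0)"
    and "AE \<omega> in M. \<forall>k\<ge>2. \<omega> 0 k = 1/2"
    and "measure M {\<omega> \<in> space M. \<omega> 0 1 = 1/2} < 1"
  shows "annealed_prob M 0 (\<lambda>X. \<forall>n>0. X n > 0) =
           (\<integral>\<omega>. \<omega> 0 0 \<partial>M) * max ((\<integral>\<omega>. delta0 \<omega> \<partial>M) - 1) 0
           / (\<integral>\<omega>. (2 * \<omega> 0 1 - 1) * \<omega> 0 0 \<partial>M)"
proof -
  interpret iid_cookies M
    by (intro iid_cookies.intro iid_cookies_axioms.intro assms)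
  obtain l where l: "(\<lambda>K. \<integral>\<omega>. hit \<omega> 0 (int K) \<partial>M) \<longlonglongrightarrow> l"
    using mean_hit_convergent by (auto simp: convergent_def)
  have "annealed_prob M 0 (\<lambda>X. \<forall>n>0. X n > 0) = (\<integral>\<omega>. \<omega> 0 0 \<partial>M) * l"
    by (rule LIMSEQ_unique[OF annealed_positive_limit tendsto_mult_left[OF l]])
  then show ?thesis by (simp only: mean_hit_limit[OF l assms(7)]) simp
qed

end
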